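(* Let $\lambda$ be an infinite cardinal and $\alpha<\lambda^+$ a limit ordinal with $\mathrm{cf}(\alpha)\ge\omega_1$. If $G$ is a $(\lambda,\alpha)$-limit model in the class of torsion-free abelian groups with the pure subgroup relation, then \[G \cong \Big(\bigoplus_{\lambda} \mathbb{Q}\Big) \oplus \prod_{p \text{ prime}} \overline{\Big(\bigoplus_{\lambda} \mathbb{Z}_{(p)}\Big)}. \]
   Context: $H\le_p G$ means $H$ is a pure subgroup of $G$: $H\le G$ and $nG\cap H=nH$ for all $n\in\mathbb{N}$. A pure embedding $f:H\to G$ is an injective homomorphism with $f[H]\le_p G$. For torsion-free $H\le_p G$ with $|G|=|H|=\lambda$, $G$ is universal over $H$ if every torsion-free $H^*$ of cardinality $\lambda$ with $H\le_p H^*$ admits a pure embedding into $G$ fixing $H$ pointwise. $G$ is a $(\lambda,\alpha)$-limit model if there is an increasing continuous chain $\langle G_i:i<\alpha\rangle$ of torsion-free groups of cardinality $\lambda$ with $G_i\le_p G_j$ for $i<j$, $G_{i+1}$ universal over $G_i$ for all $i$, and $G=\bigcup_{i<\alpha}G_i$. $\mathbb{Z}_{(p)}=\{n/m\in\mathbb{Q}:\gcd(m,p)=1\}$, and the overline denotes the completion (the $p$-adic completion / pure-injective hull). *)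

theory Defs
  imports "HOL-Algebra.Free_Abelian_Groups" "HOL-Computational_Algebra.Primes"
begin

unbundle cardinal_syntax

text \<open>
  Abelian groups are written multiplicatively: the multiple \<open>n x\<close> is the power \<open>x [^] n\<close>. Subgroups are subsets \<open>H\<close> of
  the carrier, and \<open>G\<lparr>carrier := H\<rparr>\<close> is \<open>H\<close> as a group in its own right.
\<close>

definition torsion_free_group :: "('a, 'b) monoid_scheme \<Rightarrow> bool"
  where "torsion_free_group G \<longleftrightarrow>
    comm_group G \<and>
    (\<forall>x\<in>carrier G. \<forall>n::nat. n > 0 \<longrightarrow> x [^]\<^bsub>G\<^esub> n = \<one>\<^bsub>G\<^esub> \<longrightarrow> x = \<one>\<^bsub>G\<^esub>)"

text \<open>The subgroup \<open>n G\<close>.\<close>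

definition multiples :: "('a, 'b) monoid_scheme \<Rightarrow> nat \<Rightarrow> 'a set"
  where "multiples G n = (\<lambda>x. x [^]\<^bsub>G\<^esub> n) ` carrier G"

definition pure_subgroup :: "'a set \<Rightarrow> ('a, 'b) monoid_scheme \<Rightarrow> bool"
  where "pure_subgroup H G \<longleftrightarrow>
    subgroup H G \<and> (\<forall>n. multiples G n \<inter> H = multiples (G\<lparr>carrier := H\<rparr>) n)"

definition pure_embedding ::
    "('a \<Rightarrow> 'c) \<Rightarrow> ('a, 'b) monoid_scheme \<Rightarrow> ('c, 'd) monoid_scheme \<Rightarrow> bool"
  where "pure_embedding f H G \<longleftrightarrow> f \<in> mon H G \<and> pure_subgroup (f ` carrier H) G"

text \<open>
  The extensions \<open>K\<close> of \<open>H\<close> are given by a pure embedding \<open>j\<close> of \<open>H\<close> into a group \<open>K\<close>, which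
  is identified with an inclusion: the type \<open>'a\<close> may have no elements left outside \<open>H\<close>, so that
  literal supersets of \<open>H\<close> in \<open>'a\<close> need not represent all extensions. Every group of
  cardinality \<open>\<kappa>\<close> has a copy whose carrier is a subset of \<open>'a\<close>, since \<open>H\<close> itself has
  cardinality \<open>\<kappa>\<close>; so letting \<open>K\<close> range over groups on \<open>'a\<close> is no restriction. See
  \<open>universal_over_iff_inclusion\<close> below for the version with inclusions.
\<close>

definition universal_over :: "'l rel \<Rightarrow> ('a, 'b) monoid_scheme \<Rightarrow> 'a set \<Rightarrow> bool"
  where "universal_over \<kappa> G H \<longleftrightarrow>
    torsion_free_group G \<and> pure_subgroup H G \<and> |carrier G| =o \<kappa> \<and> |H| =o \<kappa> \<and>
    (\<forall>(K :: 'a monoid) j.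
       torsion_free_group K \<and> |carrier K| =o \<kappa> \<and> pure_embedding j (G\<lparr>carrier := H\<rparr>) K \<longrightarrow>
       (\<exists>f. pure_embedding f K G \<and> (\<forall>x\<in>H. f (j x) = x)))"

text \<open>
  An ordinal is a well-order \<open>\<alpha>\<close>, and the ordinals \<open>i < \<alpha>\<close> are the elements of its field;
  \<open>i + 1 < \<alpha>\<close> means that \<open>i\<close> is not the last element. In the library \<open>wo_rel.isLim\<close> also
  holds of the least element. The chain consists of subgroups of \<open>G\<close> because \<open>G\<close> is its union.
\<close>

definition limit_model :: "'l rel \<Rightarrow> 'i rel \<Rightarrow> ('a, 'b) monoid_scheme \<Rightarrow> bool"
  where "limit_model \<kappa> \<alpha> G \<longleftrightarrow>
    comm_group G \<and>
    (\<exists>A :: 'i \<Rightarrow> 'a set.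
       (\<forall>i\<in>Field \<alpha>. torsion_free_group (G\<lparr>carrier := A i\<rparr>) \<and> |A i| =o \<kappa>) \<and>
       (\<forall>i j. (i, j) \<in> \<alpha> \<and> i \<noteq> j \<longrightarrow> pure_subgroup (A i) (G\<lparr>carrier := A j\<rparr>)) \<and>
       (\<forall>i\<in>Field \<alpha>. wo_rel.isLim \<alpha> i \<and> i \<noteq> wo_rel.zero \<alpha> \<longrightarrow> A i = (\<Union>j\<in>underS \<alpha> i. A j)) \<and>
       (\<forall>i\<in>Field \<alpha>. aboveS \<alpha> i \<noteq> {} \<longrightarrow>
          universal_over \<kappa> (G\<lparr>carrier := A (wo_rel.succ \<alpha> i)\<rparr>) (A i)) \<and>
       carrier G = (\<Union>i\<in>Field \<alpha>. A i))"

text \<open>Like \<^const>\<open>cardSuc\<close>, the cofinality is determined up to order isomorphism.\<close>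

definition is_cofinality :: "'i rel \<Rightarrow> 'i rel \<Rightarrow> bool"
  where "is_cofinality r c \<longleftrightarrow>
    (\<exists>A. A \<subseteq> Field r \<and> cofinal A r \<and> c = |A| \<and>
       (\<forall>B. B \<subseteq> Field r \<and> cofinal B r \<longrightarrow> |A| \<le>o |B| ))"

definition cofinality :: "'i rel \<Rightarrow> 'i rel"
  where "cofinality r = (SOME c. is_cofinality r c)"

definition rat_group :: "rat monoid"
  where "rat_group = \<lparr>carrier = UNIV, monoid.mult = (+), one = 0\<rparr>"

definition localized_int_group :: "nat \<Rightarrow> rat monoid"
  where "localized_int_group p =
    rat_group\<lparr>carrier := {of_int n / of_int m | n m :: int. m \<noteq> 0 \<and> coprime m (int p)}\<rparr>"

text \<open>
  The inverse limit of the quotients \<open>A / p\<^sup>n A\<close>. The canonical map \<open>A / p\<^sup>n\<^sup>+\<^sup>1 A \<rightarrow> A / p\<^sup>n A\<close>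
  sends a coset to the unique coset of \<open>p\<^sup>n A\<close> that contains it.
\<close>

definition padic_completion :: "nat \<Rightarrow> ('a, 'b) monoid_scheme \<Rightarrow> (nat \<Rightarrow> 'a set) monoid"
  where "padic_completion p A =
    (let P = product_group UNIV (\<lambda>n. A Mod multiples A (p ^ n))
     in P\<lparr>carrier := {x \<in> carrier P. \<forall>n. x (Suc n) \<subseteq> x n}\<rparr>)"

lemma is_cofinality_cofinality:
  assumes "Well_order r" "wo_rel.isLimOrd r"
  shows "is_cofinality r (cofinality r)"
proof -
  have wo: "wo_rel r" using assms(1) by (simp add: wo_rel_def)
  have "cofinal (Field r) r"
    unfolding cofinal_def
  proof
    fix a assume "a \<in> Field r"
    then obtain b where "b \<noteq> a" "(a, b) \<in> r"
      using wo_rel.isLimOrd_aboveS[OF wo assms(2)] unfolding aboveS_def by blast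
    then show "\<exists>b\<in>Field r. a \<noteq> b \<and> (a, b) \<in> r" by (metis FieldI2)
  qed
  let ?R = "{|A| | A. A \<subseteq> Field r \<and> cofinal A r}"
  have "?R \<noteq> {}" using \<open>cofinal (Field r) r\<close> by blast
  moreover have "\<forall>c\<in>?R. Card_order c" using card_of_Card_order by blast
  ultimately obtain c where "c \<in> ?R" "\<forall>d\<in>?R. c \<le>o d"
    using exists_minim_Card_order[of ?R] by blast
  then have "is_cofinality r c" unfolding is_cofinality_def by auto
  then show ?thesis unfolding cofinality_def by (rule someI)
qed

lemma torsion_free_group_transport:
  assumes K: "torsion_free_group K" and h: "inj_on h (carrier K)"
    and L: "L = \<lparr>carrier = h ` carrier K,
      monoid.mult = (\<lambda>a b. h (inv_into (carrier K) h a \<otimes>\<^bsub>K\<^esub> inv_into (carrier K) h b)),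
      one = h \<one>\<^bsub>K\<^esub>\<rparr>"
  shows "torsion_free_group L" "h \<in> iso K L"
proof -
  interpret K: comm_group K using K by (simp add: torsion_free_group_def)
  have inv: "inv_into (carrier K) h (h x) = x" if "x \<in> carrier K" for x
    using h that by simp
  show hi: "h \<in> iso K L"
    using h by (auto simp: iso_def hom_def L inv bij_betw_def)
  have L': "L = L\<lparr>one := h \<one>\<^bsub>K\<^esub>\<rparr>" by (simp add: L)
  have cL: "comm_group L" using K.iso_imp_img_comm_group[OF hi] L' by simp
  interpret L: comm_group L by (rule cL)
  have "y = \<one>\<^bsub>L\<^esub>" if y: "y \<in> carrier L" "n > 0" "y [^]\<^bsub>L\<^esub> n = \<one>\<^bsub>L\<^esub>" for y and n :: nat
  proof -
    obtain x where x: "x \<in> carrier K" "y = h x" using y(1) by (auto simp: L)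
    have "h (x [^]\<^bsub>K\<^esub> n) = y [^]\<^bsub>L\<^esub> n"
      using hom_nat_pow[of h K L x n] hi x K.is_group L.is_group by (simp add: iso_def)
    then have "h (x [^]\<^bsub>K\<^esub> n) = h \<one>\<^bsub>K\<^esub>" using y(3) by (simp add: L)
    then have "x [^]\<^bsub>K\<^esub> n = \<one>\<^bsub>K\<^esub>" using h x(1) by (meson inj_onD K.nat_pow_closed K.one_closed)
    then have "x = \<one>\<^bsub>K\<^esub>" using K x(1) y(2) by (auto simp: torsion_free_group_def)
    then show ?thesis using x(2) by (simp add: L)
  qed
  then show "torsion_free_group L" using cL by (auto simp: torsion_free_group_def)
qed

lemma pure_subgroup_image_iso:
  assumes K: "group K" and L: "group L" and h: "h \<in> iso K L" and S: "pure_subgroup S K"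
  shows "pure_subgroup (h ` S) L"
proof -
  have hom: "h \<in> hom K L" and inj: "inj_on h (carrier K)" and im: "h ` carrier K = carrier L"
    using h by (auto simp: iso_def bij_betw_def)
  have sub: "subgroup S K" and SK: "S \<subseteq> carrier K"
    using S subgroup.subset by (auto simp: pure_subgroup_def)
  have pw: "h (x [^]\<^bsub>K\<^esub> n) = h x [^]\<^bsub>L\<^esub> n" if "x \<in> carrier K" for x and n :: nat
    using hom_nat_pow[OF hom that K L] .
  interpret hh: group_hom K L h using K L hom by (simp add: group_hom_def group_hom_axioms_def)
  have "subgroup (h ` S) L" using hh.subgroup_img_is_subgroup[OF sub] .
  moreover have "multiples L n \<inter> h ` S = multiples (L\<lparr>carrier := h ` S\<rparr>) n" for n
  proof -
    have 1: "multiples L n = h ` multiples K n"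
      unfolding multiples_def im[symmetric] image_image by (rule image_cong) (auto simp: pw)
    have 2: "multiples (L\<lparr>carrier := h ` S\<rparr>) n = h ` multiples (K\<lparr>carrier := S\<rparr>) n"
    proof -
      have "multiples (L\<lparr>carrier := h ` S\<rparr>) n = (\<lambda>x. h x [^]\<^bsub>L\<^esub> n) ` S"
        unfolding multiples_def by (simp add: image_image flip: hh.H.nat_pow_consistent)
      also have "\<dots> = (\<lambda>x. h (x [^]\<^bsub>K\<^esub> n)) ` S"
        by (rule image_cong) (use SK pw in auto)
      also have "\<dots> = h ` multiples (K\<lparr>carrier := S\<rparr>) n"
        unfolding multiples_def by (simp add: image_image flip: hh.G.nat_pow_consistent)
      finally show ?thesis .
    qed
    have "multiples K n \<subseteq> carrier K" unfolding multiples_def by auto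
    then have "h ` multiples K n \<inter> h ` S = h ` (multiples K n \<inter> S)"
      using inj_on_image_Int[OF inj _ SK] by blast
    then show ?thesis using S 1 2 by (simp add: pure_subgroup_def)
  qed
  ultimately show ?thesis by (simp add: pure_subgroup_def)
qed

text \<open>If \<open>'a\<close> has enough elements outside \<open>H\<close>, inclusions suffice.\<close>

lemma universal_over_iff_inclusion:
  fixes G :: "('a, 'b) monoid_scheme"
  assumes room: "\<kappa> \<le>o |UNIV - H|"
  shows "universal_over \<kappa> G H \<longleftrightarrow>
    torsion_free_group G \<and> pure_subgroup H G \<and> |carrier G| =o \<kappa> \<and> |H| =o \<kappa> \<and>
    (\<forall>K :: 'a monoid.
       torsion_free_group K \<and> |carrier K| =o \<kappa> \<and> pure_subgroup H K \<and>
       (\<forall>x\<in>H. \<forall>y\<in>H. x \<otimes>\<^bsub>K\<^esub> y = x \<otimes>\<^bsub>G\<^esub> y) \<longrightarrow>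
       (\<exists>f. pure_embedding f K G \<and> (\<forall>x\<in>H. f x = x)))"
    (is "_ \<longleftrightarrow> ?base1 \<and> ?base2 \<and> ?base3 \<and> ?base4 \<and> ?R")
proof -
  have "(\<forall>(K :: 'a monoid) j.
       torsion_free_group K \<and> |carrier K| =o \<kappa> \<and> pure_embedding j (G\<lparr>carrier := H\<rparr>) K \<longrightarrow>
       (\<exists>f. pure_embedding f K G \<and> (\<forall>x\<in>H. f (j x) = x))) \<longleftrightarrow> ?R" (is "?L \<longleftrightarrow> ?R")
    if G: ?base1 and HG: ?base2 and cH: ?base4
  proof
    assume L: ?L
    show ?R
    proof (intro allI impI, elim conjE)
      fix K :: "'a monoid"
      assume K: "torsion_free_group K" "|carrier K| =o \<kappa>" "pure_subgroup H K"
        "\<forall>x\<in>H. \<forall>y\<in>H. x \<otimes>\<^bsub>K\<^esub> y = x \<otimes>\<^bsub>G\<^esub> y"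
      have "H \<subseteq> carrier K" using K(3) subgroup.subset by (auto simp: pure_subgroup_def)
      then have "pure_embedding (\<lambda>x. x) (G\<lparr>carrier := H\<rparr>) K"
        using K(3,4) by (auto simp: pure_embedding_def mon_def hom_def)
      then show "\<exists>f. pure_embedding f K G \<and> (\<forall>x\<in>H. f x = x)"
        using L K(1,2) by blast
    qed
  next
    assume R: ?R
    show ?L
    proof (intro allI impI, elim conjE)
      fix K :: "'a monoid" and j
      assume K: "torsion_free_group K" "|carrier K| =o \<kappa>"
        and j: "pure_embedding j (G\<lparr>carrier := H\<rparr>) K"
      interpret G: comm_group G using G by (simp add: torsion_free_group_def)
      interpret K: comm_group K using K by (simp add: torsion_free_group_def)
      have injj: "inj_on j H" and jK: "j ` H \<subseteq> carrier K" and pj: "pure_subgroup (j ` H) K"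
        and jhom: "\<And>x y. x \<in> H \<Longrightarrow> y \<in> H \<Longrightarrow> j (x \<otimes>\<^bsub>G\<^esub> y) = j x \<otimes>\<^bsub>K\<^esub> j y"
        using j by (auto simp: pure_embedding_def mon_def hom_def)
      have Hcl: "x \<otimes>\<^bsub>G\<^esub> y \<in> H" if "x \<in> H" "y \<in> H" for x y
        using HG that by (simp add: pure_subgroup_def subgroup.m_closed)
      have "|carrier K| \<le>o |UNIV - H|" using K(2) room ordIso_ordLeq_trans by blast
      then obtain g where g: "inj_on g (carrier K)" "g ` carrier K \<subseteq> UNIV - H"
        using card_of_ordLeq[of "carrier K" "UNIV - H"] by blast
      define h where "h y = (if y \<in> j ` H then inv_into H j y else g y)" for y
      have hj: "h (j x) = x" if "x \<in> H" for x using that injj by (simp add: h_def)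
      have injh: "inj_on h (carrier K)"
      proof (rule inj_onI)
        fix a b assume ab: "a \<in> carrier K" "b \<in> carrier K" "h a = h b"
        have out: "h y \<notin> H" if "y \<in> carrier K" "y \<notin> j ` H" for y
          using that g(2) by (auto simp: h_def)
        have inn: "h y \<in> H" if "y \<in> j ` H" for y using that hj by auto
        consider "a \<in> j ` H" "b \<in> j ` H" | "a \<notin> j ` H" "b \<notin> j ` H"
          using ab out inn by metis
        then show "a = b"
        proof cases
          case 1 then show ?thesis using ab(3) hj by auto
        next
          case 2 then show ?thesis using ab g(1) by (simp add: h_def inj_on_def)
        qed
      qed
      define N where "N = \<lparr>carrier = h ` carrier K,
        monoid.mult = (\<lambda>a b. h (inv_into (carrier K) h a \<otimes>\<^bsub>K\<^esub> inv_into (carrier K) h b)),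
        one = h \<one>\<^bsub>K\<^esub>\<rparr>"
      note N = torsion_free_group_transport[OF K(1) injh N_def]
      interpret N: comm_group N using N(1) by (simp add: torsion_free_group_def)
      have "|carrier N| =o |carrier K|"
        using card_of_ordIsoI[of h "carrier K" "carrier N"] N(2) ordIso_symmetric
        by (auto simp: iso_def)
      then have cN: "|carrier N| =o \<kappa>" using K(2) ordIso_transitive by blast
      have hjH: "h ` j ` H = H" using hj by force
      have pN: "pure_subgroup H N"
        using pure_subgroup_image_iso[OF K.is_group N.is_group N(2) pj] hjH by simp
      have ih: "inv_into (carrier K) h x = j x" if "x \<in> H" for x
        using hj[OF that] injh jK that by (metis image_subset_iff inv_into_f_f)
      have "\<forall>x\<in>H. \<forall>y\<in>H. x \<otimes>\<^bsub>N\<^esub> y = x \<otimes>\<^bsub>G\<^esub> y"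
        by (simp add: N_def ih hj Hcl flip: jhom)
      then obtain f where f: "pure_embedding f N G" "\<forall>x\<in>H. f x = x"
        using R N(1) cN pN by blast
      have hK: "h ` carrier K = carrier N" by (simp add: N_def)
      have "f \<circ> h \<in> mon K G"
        using f(1) N(2) hK injh
        by (auto simp: pure_embedding_def mon_def iso_def intro: hom_compose comp_inj_on)
      moreover have "(f \<circ> h) ` carrier K = f ` carrier N" using hK by (metis image_comp)
      ultimately have "pure_embedding (f \<circ> h) K G" using f(1) by (simp add: pure_embedding_def)
      moreover have "\<forall>x\<in>H. (f \<circ> h) (j x) = x" using f(2) hj by simp
      ultimately show "\<exists>f. pure_embedding f K G \<and> (\<forall>x\<in>H. f (j x) = x)" by blast
    qed
  qed
  then show ?thesis unfolding universal_over_def by blast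
qed

end

theory Submission
  imports Defs
begin

text \<open>
  Uncountable cofinality makes \<open>G\<close> countably saturated: any countably many elements lie in some \<open>G\<^sub>i\<close>,
  and a countable system of congruences that is finitely solvable in \<open>G\<^sub>i\<close> has a solution in a
  pure extension of \<open>G\<^sub>i\<close> of cardinality \<open>\<lambda>\<close>, hence in the universal \<open>G\<^sub>i\<^sub>+\<^sub>1\<close>. So \<open>G\<close>
  maps onto its profinite (\<open>\<int>\<close>-adic) completion, with kernel the divisible part \<open>D\<close>. That completion is
  the product over the primes of the \<open>p\<close>-adic completions, and the latter depend only on the dimension
  of \<open>G / p G\<close>. A maximal independent subset of \<open>D\<close>, extended to one of \<open>G\<close>, gives rational
  coordinates on \<open>G\<close> that restrict to an isomorphism of \<open>D\<close> with a direct sum of copies of \<open>\<rat>\<close>.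
  All dimensions are \<open>\<lambda>\<close>, because every torsion-free group of cardinality at most \<open>\<lambda>\<close> embeds purely
  in \<open>G\<close>: start from the image of a basis of \<open>\<Oplus>\<^sub>\<lambda> \<rat>\<close> or \<open>\<Oplus>\<^sub>\<lambda> \<int>\<^sub>(\<^sub>p\<^sub>)\<close> and extend it to a
  maximal independent set, whose cardinality is then squeezed between \<open>\<lambda>\<close> and \<open>|G|\<close>.
\<close>

section \<open>Pure subgroups and embeddings\<close>

text \<open>No complement of \<open>D\<close> is ever chosen. The isomorphism is the single map
  sending \<open>g\<close> to its rational coordinates together with its images in all p-adic
  completions. Elements with equal images in the completions differ by an element of
  \<open>D\<close>, where the coordinates are faithful; and an element with prescribed images can be
  corrected by an element of \<open>D\<close> without disturbing them. This is why the coordinates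
  must be defined on all of \<open>G\<close>.

  A homomorphism between \<open>G\<close> and the sum \<open>A\<close> of localized integers that is
  bijective modulo \<open>p\<close> is not at hand. Both therefore receive a homomorphism from the
  free abelian group on \<open>Field \<kappa>\<close>: one given by a basis modulo \<open>p\<close>,
  the other being the inclusion. Torsion-freeness lifts bijectivity modulo \<open>p\<close> to every
  \<open>p ^ n\<close>, and passing through the free group relates the residues of \<open>G\<close>
  to those of \<open>A\<close>.

  The primes cannot be treated one at a time, since a single element has to meet the prescribed
  residues at all of them. Hence the congruences for all prime powers form one countable
  system.\<close>

lemma pure_subgroup_iff:
  assumes "group G"
  shows "pure_subgroup H G \<longleftrightarrow>
    subgroup H G \<and> (\<forall>x\<in>carrier G. \<forall>n::nat. x [^]\<^bsub>G\<^esub> n \<in> H \<longrightarrow> (\<exists>y\<in>H. y [^]\<^bsub>G\<^esub> n = x [^]\<^bsub>G\<^esub> n))"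
proof (cases "subgroup H G")
  case True
  interpret group G by fact
  have m: "multiples (G\<lparr>carrier := H\<rparr>) n = (\<lambda>x. x [^]\<^bsub>G\<^esub> n) ` H" for n
    unfolding multiples_def by (simp flip: nat_pow_consistent)
  have HG: "H \<subseteq> carrier G" using True by (simp add: subgroup.subset)
  have Hp: "x [^]\<^bsub>G\<^esub> n \<in> H" if "x \<in> H" for x and n :: nat
    using True that by (induction n) (auto intro: subgroup.m_closed subgroup.one_closed)
  have "(multiples G n \<inter> H = multiples (G\<lparr>carrier := H\<rparr>) n) \<longleftrightarrow>
      (\<forall>x\<in>carrier G. x [^]\<^bsub>G\<^esub> n \<in> H \<longrightarrow> (\<exists>y\<in>H. y [^]\<^bsub>G\<^esub> n = x [^]\<^bsub>G\<^esub> n))" (is "?L n \<longleftrightarrow> ?R n")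
    for n :: nat
  proof
    assume L: "?L n"
    show "?R n"
    proof (intro ballI impI)
      fix x assume "x \<in> carrier G" "x [^]\<^bsub>G\<^esub> n \<in> H"
      then have "x [^]\<^bsub>G\<^esub> n \<in> (\<lambda>x. x [^]\<^bsub>G\<^esub> n) ` H"
        using L[unfolded m] by (auto simp: multiples_def)
      then show "\<exists>y\<in>H. y [^]\<^bsub>G\<^esub> n = x [^]\<^bsub>G\<^esub> n" by (metis (no_types, lifting) imageE)
    qed
  next
    assume R: "?R n"
    show "?L n" unfolding m unfolding multiples_def
    proof (rule equalityI)
      show "(\<lambda>x. x [^]\<^bsub>G\<^esub> n) ` carrier G \<inter> H \<subseteq> (\<lambda>x. x [^]\<^bsub>G\<^esub> n) ` H"
      proof
        fix y assume "y \<in> (\<lambda>x. x [^]\<^bsub>G\<^esub> n) ` carrier G \<inter> H"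
        then obtain x where "x \<in> carrier G" "y = x [^]\<^bsub>G\<^esub> n" "x [^]\<^bsub>G\<^esub> n \<in> H" by auto
        then obtain z where "z \<in> H" "z [^]\<^bsub>G\<^esub> n = y" using R by auto
        then show "y \<in> (\<lambda>x. x [^]\<^bsub>G\<^esub> n) ` H" by auto
      qed
      show "(\<lambda>x. x [^]\<^bsub>G\<^esub> n) ` H \<subseteq> (\<lambda>x. x [^]\<^bsub>G\<^esub> n) ` carrier G \<inter> H" using HG Hp by auto
    qed
  qed
  then show ?thesis using True unfolding pure_subgroup_def by auto
qed (simp add: pure_subgroup_def)

text \<open>Stated through elements instead of images, purity is reflection of divisibility along
  \<open>f\<close>, which composes directly and can be tested coordinatewise in direct
  products.\<close>

lemma pure_embedding_iff:
  assumes "group H" "group G"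
  shows "pure_embedding f H G \<longleftrightarrow> f \<in> mon H G \<and>
    (\<forall>x\<in>carrier H. \<forall>y\<in>carrier G. \<forall>n::nat. y [^]\<^bsub>G\<^esub> n = f x \<longrightarrow> (\<exists>z\<in>carrier H. z [^]\<^bsub>H\<^esub> n = x))"
proof (cases "f \<in> mon H G")
  case True
  then interpret group_hom H G f
    using assms by (simp add: group_hom_def group_hom_axioms_def mon_def)
  have inj: "inj_on f (carrier H)" using True by (simp add: mon_def)
  have "z [^]\<^bsub>H\<^esub> n = x \<longleftrightarrow> f z [^]\<^bsub>G\<^esub> n = f x"
    if "x \<in> carrier H" "z \<in> carrier H" for x z and n :: nat
    using inj_on_eq_iff[OF inj, of "z [^]\<^bsub>H\<^esub> n" x] that by (simp add: hom_nat_pow)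
  then have *: "(\<exists>z\<in>carrier H. z [^]\<^bsub>H\<^esub> n = x) \<longleftrightarrow> (\<exists>z\<in>f ` carrier H. z [^]\<^bsub>G\<^esub> n = f x)"
    if "x \<in> carrier H" for x and n :: nat
    using that by auto
  have "subgroup (f ` carrier H) G" by (rule img_is_subgroup)
  then have "pure_embedding f H G \<longleftrightarrow>
    (\<forall>y\<in>carrier G. \<forall>n::nat. y [^]\<^bsub>G\<^esub> n \<in> f ` carrier H \<longrightarrow>
      (\<exists>z\<in>f ` carrier H. z [^]\<^bsub>G\<^esub> n = y [^]\<^bsub>G\<^esub> n))"
    using True by (simp add: pure_embedding_def pure_subgroup_iff[OF assms(2)])
  also have "\<dots> \<longleftrightarrow> (\<forall>x\<in>carrier H. \<forall>y\<in>carrier G. \<forall>n::nat. y [^]\<^bsub>G\<^esub> n = f x \<longrightarrow>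
      (\<exists>z\<in>f ` carrier H. z [^]\<^bsub>G\<^esub> n = f x))" (is "?L \<longleftrightarrow> ?R")
  proof
    assume L: ?L
    show ?R
    proof (intro ballI allI impI)
      fix x y and n :: nat assume "x \<in> carrier H" "y \<in> carrier G" "y [^]\<^bsub>G\<^esub> n = f x"
      then show "\<exists>z\<in>f ` carrier H. z [^]\<^bsub>G\<^esub> n = f x" using L[rule_format, of y n] by simp
    qed
  next
    assume R: ?R
    show ?L
    proof (intro ballI allI impI)
      fix y and n :: nat assume y: "y \<in> carrier G" "y [^]\<^bsub>G\<^esub> n \<in> f ` carrier H"
      then obtain x where "x \<in> carrier H" "y [^]\<^bsub>G\<^esub> n = f x" by blast
      then show "\<exists>z\<in>f ` carrier H. z [^]\<^bsub>G\<^esub> n = y [^]\<^bsub>G\<^esub> n" using R[rule_format, of x y n] y by simp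
    qed
  qed
  finally show ?thesis using True * by simp
qed (simp add: pure_embedding_def)

lemma pure_embedding_comp:
  assumes "group H" "group K" "group G" "pure_embedding f H K" "pure_embedding g K G"
  shows "pure_embedding (g \<circ> f) H G"
proof -
  have f: "f \<in> mon H K" and g: "g \<in> mon K G" using assms by (auto simp: pure_embedding_def)
  have fc: "f x \<in> carrier K" if "x \<in> carrier H" for x
    using that f by (auto simp: mon_def hom_def)
  have "g \<circ> f \<in> mon H G"
    using f g fc by (auto simp: mon_def intro: hom_compose comp_inj_on inj_on_subset)
  moreover have "\<exists>z\<in>carrier H. z [^]\<^bsub>H\<^esub> n = x"
    if xy: "x \<in> carrier H" "y \<in> carrier G" "y [^]\<^bsub>G\<^esub> n = g (f x)" for x y and n :: nat
  proof -
    obtain w where "w \<in> carrier K" "w [^]\<^bsub>K\<^esub> n = f x"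
      using xy fc[of x] assms(5) unfolding pure_embedding_iff[OF assms(2,3)] by blast
    then show ?thesis using xy assms(4) unfolding pure_embedding_iff[OF assms(1,2)] by blast
  qed
  ultimately show ?thesis by (simp add: pure_embedding_iff[OF assms(1,3)])
qed

lemma pure_embedding_inclusion:
  "pure_embedding (\<lambda>x. x) (G\<lparr>carrier := H\<rparr>) G \<longleftrightarrow> pure_subgroup H G"
  by (auto simp: pure_embedding_def pure_subgroup_def mon_def hom_def dest: subgroup.subset)

lemma torsion_free_group_subgroup:
  assumes "torsion_free_group G" "subgroup H G"
  shows "torsion_free_group (G\<lparr>carrier := H\<rparr>)"
proof -
  interpret comm_group G using assms by (simp add: torsion_free_group_def)
  have "comm_group (G\<lparr>carrier := H\<rparr>)"
    by (rule group.group_comm_groupI[OF subgroup_imp_group[OF assms(2)]])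
      (use subgroup.subset[OF assms(2)] in \<open>auto intro: m_comm\<close>)
  then show ?thesis
    using assms subgroup.subset[OF assms(2)]
    by (auto simp: torsion_free_group_def simp flip: nat_pow_consistent)
qed

lemma torsion_free_group_pow_inject:
  assumes "torsion_free_group G" "x \<in> carrier G" "y \<in> carrier G" "n > 0"
    "x [^]\<^bsub>G\<^esub> n = y [^]\<^bsub>G\<^esub> (n::nat)"
  shows "x = y"
proof -
  interpret comm_group G using assms by (simp add: torsion_free_group_def)
  have "(x \<otimes>\<^bsub>G\<^esub> inv\<^bsub>G\<^esub> y) [^]\<^bsub>G\<^esub> n = \<one>\<^bsub>G\<^esub>"
    using assms by (simp add: nat_pow_distrib nat_pow_inv)
  then have "x \<otimes>\<^bsub>G\<^esub> inv\<^bsub>G\<^esub> y = \<one>\<^bsub>G\<^esub>"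
    using assms by (simp add: torsion_free_group_def)
  then show ?thesis using assms by (metis inv_closed inv_equality inv_inv)
qed

text \<open>Roots are unique in a torsion-free group, so \<open>y\<close> is determined by an
  exponent \<open>e y\<close> and the corresponding power. This bounds both pure closures and direct
  sums of rationals.\<close>

lemma card_of_roots_ordLeq:
  assumes "torsion_free_group G" "S \<subseteq> carrier G" "\<And>y. y \<in> S \<Longrightarrow> \<exists>n>0. y [^]\<^bsub>G\<^esub> (n::nat) \<in> T"
    "|T| \<le>o \<kappa>" "Cinfinite \<kappa>"
  shows "|S| \<le>o \<kappa>"
proof -
  define e where "e y = (SOME n::nat. n > 0 \<and> y [^]\<^bsub>G\<^esub> n \<in> T)" for y
  have e: "e y > 0" "y [^]\<^bsub>G\<^esub> e y \<in> T" if "y \<in> S" for y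
    using someI_ex[OF assms(3)[OF that]] by (auto simp: e_def)
  have "inj_on (\<lambda>y. (y [^]\<^bsub>G\<^esub> e y, e y)) S"
  proof (rule inj_onI)
    fix x y assume "x \<in> S" "y \<in> S" "(x [^]\<^bsub>G\<^esub> e x, e x) = (y [^]\<^bsub>G\<^esub> e y, e y)"
    then show "x = y"
      using e(1)[of y] subsetD[OF assms(2)] torsion_free_group_pow_inject[OF assms(1), of x y "e y"] by auto
  qed
  then have "|S| \<le>o |T \<times> (UNIV :: nat set)|" by (rule card_of_ordLeqI) (use e in auto)
  also have "|T \<times> (UNIV :: nat set)| \<le>o \<kappa>"
    using assms(4,5) card_of_nat natLeq_ordLeq_cinfinite[OF assms(5)]
    by (intro card_of_Times_ordLeq_infinite_Field) (auto simp: cinfinite_def intro: ordIso_ordLeq_trans)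
  finally show ?thesis .
qed

text \<open>Universality speaks only of groups on the type \<open>'a\<close> of cardinality exactly
  \<open>\<kappa>\<close>. Since \<open>j\<close> is injective and \<open>H\<close> has cardinality
  \<open>\<kappa>\<close>, so has \<open>K\<close>, and a copy of \<open>K\<close> fits on a subset
  of \<open>'a\<close>.\<close>

lemma universal_over_embedding:
  fixes G :: "('a, 'b) monoid_scheme" and K :: "('c, 'd) monoid_scheme"
  assumes U: "universal_over \<kappa> G H" and K: "torsion_free_group K" "|carrier K| \<le>o \<kappa>"
    and j: "pure_embedding j (G\<lparr>carrier := H\<rparr>) K"
  obtains f where "pure_embedding f K G" "\<And>x. x \<in> H \<Longrightarrow> f (j x) = x"
proof -
  have G: "torsion_free_group G" "pure_subgroup H G" "|H| =o \<kappa>"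
    using U by (auto simp: universal_over_def)
  interpret G: comm_group G using G by (simp add: torsion_free_group_def)
  interpret K: comm_group K using K by (simp add: torsion_free_group_def)
  have sub: "subgroup H G" using G by (simp add: pure_subgroup_def)
  have gH: "group (G\<lparr>carrier := H\<rparr>)" using sub by (rule G.subgroup_imp_group)
  have "|H| \<le>o |carrier K|"
    by (rule card_of_ordLeqI[of j]) (use j in \<open>auto simp: pure_embedding_def mon_def hom_def\<close>)
  then have "|carrier K| =o |H|"
    using K(2) G(3) by (meson ordIso_iff_ordLeq ordLeq_transitive)
  \<comment> \<open>The set \<open>H\<close> merely supplies enough elements of type
    \<open>'a\<close>: the copy \<open>L\<close> of \<open>K\<close> has carrier \<open>H\<close>,
    but its operation is unrelated to that of \<open>G\<close>, and \<open>h \<circ> j\<close> need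
    not be the identity.\<close>
  then obtain h where h: "bij_betw h (carrier K) H"
    using card_of_ordIso by blast
  define L where "L = \<lparr>carrier = h ` carrier K,
        monoid.mult = (\<lambda>a b. h (inv_into (carrier K) h a \<otimes>\<^bsub>K\<^esub> inv_into (carrier K) h b)),
        one = h \<one>\<^bsub>K\<^esub>\<rparr>"
  have injh: "inj_on h (carrier K)" using h by (simp add: bij_betw_def)
  note L = torsion_free_group_transport[OF K(1) injh L_def]
  interpret L: comm_group L using L(1) by (simp add: torsion_free_group_def)
  have hK: "h ` carrier K = carrier L" by (simp add: L_def)
  have "pure_embedding h K L"
    unfolding pure_embedding_def
  proof
    show "h \<in> mon K L" using L(2) by (auto simp: mon_def iso_def bij_betw_def)
    show "pure_subgroup (h ` carrier K) L"
      unfolding hK by (auto simp: pure_subgroup_iff L.subgroup_self)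
  qed
  note hp = this
  have "|carrier L| =o \<kappa>"
    using h G(3) hK by (simp add: bij_betw_def)
  then obtain f where f: "pure_embedding f L G" "\<forall>x\<in>H. f ((h \<circ> j) x) = x"
    using U L(1) pure_embedding_comp[OF gH K.is_group L.is_group j hp]
    unfolding universal_over_def by blast
  show thesis
  proof (rule that)
    show "pure_embedding (f \<circ> h) K G"
      using pure_embedding_comp[OF K.is_group L.is_group G.is_group hp f(1)] .
  qed (use f in auto)
qed

text \<open>
  The pure closure of \<open>\<langle>H, x\<rangle>\<close> in the reduced power \<open>H\<^sup>\<nat> / \<sim>\<close>, where sequences that agree eventually are
  identified, solves every system of congruences whose finite parts are solved by the \<open>h n\<close>:
  take \<open>x\<close> to be the class of \<open>h\<close>.
\<close>

lemma pure_extension_realizing: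
  fixes H :: "('a, 'b) monoid_scheme" and g h :: "nat \<Rightarrow> 'a" and m :: "nat \<Rightarrow> nat"
  assumes H: "torsion_free_group H" "|carrier H| \<le>o \<kappa>" "Cinfinite \<kappa>"
    and h: "\<And>n. h n \<in> carrier H" and g: "\<And>j. g j \<in> carrier H"
    and sol: "\<And>n j. j \<le> n \<Longrightarrow> \<exists>w\<in>carrier H. h n = g j \<otimes>\<^bsub>H\<^esub> w [^]\<^bsub>H\<^esub> m j"
    and m: "\<And>j. m j > 0"
  obtains K :: "(nat \<Rightarrow> 'a) set monoid" and d x
  where "torsion_free_group K" "|carrier K| \<le>o \<kappa>" "pure_embedding d H K" "x \<in> carrier K"
    "\<forall>j. \<exists>w\<in>carrier K. x = d (g j) \<otimes>\<^bsub>K\<^esub> w [^]\<^bsub>K\<^esub> m j"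
proof -
  interpret H: comm_group H using H by (simp add: torsion_free_group_def)
  define P where "P = product_group (UNIV :: nat set) (\<lambda>_. H)"
  have cP: "carrier P = {x. \<forall>n. x n \<in> carrier H}"
    by (auto simp: P_def PiE_iff)
  have mP: "x \<otimes>\<^bsub>P\<^esub> y = (\<lambda>n. x n \<otimes>\<^bsub>H\<^esub> y n)" for x y by (simp add: P_def restrict_def)
  have oP: "\<one>\<^bsub>P\<^esub> = (\<lambda>n. \<one>\<^bsub>H\<^esub>)" by (simp add: P_def restrict_def)
  have "group P" by (simp add: P_def)
  then interpret P: comm_group P
    by (rule group.group_comm_groupI) (auto simp: cP mP H.m_comm)
  have pP: "x [^]\<^bsub>P\<^esub> k = (\<lambda>n. x n [^]\<^bsub>H\<^esub> k)" for x and k :: nat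
    by (induction k) (auto simp: mP oP)
  have iP: "inv\<^bsub>P\<^esub> x = (\<lambda>n. inv\<^bsub>H\<^esub> x n)" if "x \<in> carrier P" for x
    using that by (intro P.inv_equality) (auto simp: cP mP oP)
  \<comment> \<open>The congruence modulo \<open>m j\<close> may fail at indices below
    \<open>j\<close>. Factoring out the eventually trivial sequences makes all of them hold at
    once.\<close>
  define N where "N = {x \<in> carrier P. \<forall>\<^sub>F n in sequentially. x n = \<one>\<^bsub>H\<^esub>}"
  have "subgroup N P"
  proof (rule P.subgroupI)
    show "N \<noteq> {}" using P.one_closed by (force simp: N_def oP)
    show "inv\<^bsub>P\<^esub> a \<in> N" if "a \<in> N" for a
      using that P.inv_closed[of a] by (auto simp: N_def iP elim: eventually_mono)
    show "a \<otimes>\<^bsub>P\<^esub> b \<in> N" if "a \<in> N" "b \<in> N" for a b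
      using that P.m_closed[of a b] by (auto simp: N_def mP elim: eventually_elim2)
  qed (auto simp: N_def)
  then interpret N: normal N P by (rule P.subgroup_imp_normal)
  have sN: "subgroup N P" by fact
  define Q where "Q = P Mod N"
  interpret Q: comm_group Q unfolding Q_def by (rule P.abelian_FactGroup[OF sN])
  define c where "c x = N #>\<^bsub>P\<^esub> x" for x
  have c_hom: "c \<in> hom P Q"
    unfolding c_def Q_def by (rule N.r_coset_hom_Mod)
  interpret c: group_hom P Q c
    using c_hom by (simp add: group_hom_def group_hom_axioms_def)
  have cQ: "carrier Q = c ` carrier P" by (simp add: Q_def c_def carrier_FactGroup)
  have c_eq: "c x = c y \<longleftrightarrow> (\<forall>\<^sub>F n in sequentially. x n = y n)"
    if "x \<in> carrier P" "y \<in> carrier P" for x y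
  proof -
    have "c x = c y \<longleftrightarrow> x \<otimes>\<^bsub>P\<^esub> inv\<^bsub>P\<^esub> y \<in> N"
      unfolding c_def using that by (metis N.rcos_module P.rcos_self P.repr_independence sN P.is_group)
    also have "\<dots> \<longleftrightarrow> (\<forall>\<^sub>F n in sequentially. x n \<otimes>\<^bsub>H\<^esub> inv\<^bsub>H\<^esub> y n = \<one>\<^bsub>H\<^esub>)"
    proof -
      have "x \<otimes>\<^bsub>P\<^esub> inv\<^bsub>P\<^esub> y = (\<lambda>n. x n \<otimes>\<^bsub>H\<^esub> inv\<^bsub>H\<^esub> y n)"
        unfolding mP iP[OF that(2)] ..
      then show ?thesis
        using P.m_closed[OF that(1) P.inv_closed[OF that(2)]] unfolding N_def by (simp only: mem_Collect_eq simp_thms)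
    qed
    also have "\<dots> \<longleftrightarrow> (\<forall>\<^sub>F n in sequentially. x n = y n)"
    proof (rule eventually_cong[OF always_eventually], rule allI)
      fix n show "x n \<otimes>\<^bsub>H\<^esub> inv\<^bsub>H\<^esub> y n = \<one>\<^bsub>H\<^esub> \<longleftrightarrow> x n = y n"
        using that by (auto simp: cP) (metis H.inv_closed H.inv_equality H.inv_inv)
    qed
    finally show ?thesis .
  qed
  have Q: "torsion_free_group Q"
    unfolding torsion_free_group_def
  proof (intro conjI ballI allI impI)
    show "comm_group Q" by (rule Q.comm_group_axioms)
    fix y and n :: nat assume y: "y \<in> carrier Q" and n: "0 < n" "y [^]\<^bsub>Q\<^esub> n = \<one>\<^bsub>Q\<^esub>"
    obtain x where x: "x \<in> carrier P" "y = c x" using y cQ by auto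
    have "c (x [^]\<^bsub>P\<^esub> n) = c \<one>\<^bsub>P\<^esub>" using n x by (simp add: c.hom_nat_pow)
    then have "\<forall>\<^sub>F k in sequentially. x k [^]\<^bsub>H\<^esub> n = \<one>\<^bsub>H\<^esub>"
      using c_eq[of "x [^]\<^bsub>P\<^esub> n" "\<one>\<^bsub>P\<^esub>"] P.nat_pow_closed[OF x(1), of n] P.one_closed by (simp add: pP oP)
    then have "\<forall>\<^sub>F k in sequentially. x k = \<one>\<^bsub>H\<^esub>"
      by (rule eventually_mono) (use H(1) n(1) x in \<open>auto simp: torsion_free_group_def cP\<close>)
    then have "c x = c \<one>\<^bsub>P\<^esub>" using x P.one_closed by (subst c_eq) (auto simp: oP)
    then show "y = \<one>\<^bsub>Q\<^esub>" using x by simp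
  qed
  define d where "d a = c (\<lambda>_. a)" for a
  have dP: "(\<lambda>_. a) \<in> carrier P" if "a \<in> carrier H" for a using that by (simp add: cP)
  have d_hom: "d \<in> hom H Q"
    using dP c.hom_mult by (auto simp: hom_def d_def mP simp flip: c.hom_mult)
  interpret d: group_hom H Q d
    using d_hom by (simp add: group_hom_def group_hom_axioms_def)
  define x where "x = c h"
  have hP: "h \<in> carrier P" using h by (simp add: cP)
  then have xQ: "x \<in> carrier Q" by (simp add: x_def)
  \<comment> \<open>\<open>Q\<close> can have more than \<open>\<kappa>\<close> elements, so only a
    small part is kept: \<open>T\<close> is generated by the image of \<open>d\<close> and by
    \<open>x\<close>, and the set \<open>S\<close> of its roots is its pure closure.\<close>
  define T where "T = (\<lambda>(a, z::int). d a \<otimes>\<^bsub>Q\<^esub> x [^]\<^bsub>Q\<^esub> z) ` (carrier H \<times> UNIV)"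
  have T: "|T| \<le>o \<kappa>"
  proof -
    have "|T| \<le>o |carrier H \<times> (UNIV :: int set)|" unfolding T_def by (rule card_of_image)
    also have "|UNIV :: int set| \<le>o \<kappa>"
      using card_of_ordLeqI[of to_nat "UNIV :: int set" UNIV] card_of_nat natLeq_ordLeq_cinfinite[OF H(3)]
      by (meson UNIV_I inj_to_nat ordLeq_ordIso_trans ordLeq_transitive)
    then have "|carrier H \<times> (UNIV :: int set)| \<le>o \<kappa>"
      using H(2,3) by (intro card_of_Times_ordLeq_infinite_Field) (auto simp: cinfinite_def)
    finally show ?thesis .
  qed
  have Tmem: "d a \<otimes>\<^bsub>Q\<^esub> x [^]\<^bsub>Q\<^esub> z \<in> T" if "a \<in> carrier H" for a and z :: int
    using that by (force simp: T_def)
  have sT: "subgroup T Q"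
  proof (rule Q.subgroupI)
    show "T \<subseteq> carrier Q" using xQ by (auto simp: T_def)
    show "T \<noteq> {}" by (auto simp: T_def)
    show "inv\<^bsub>Q\<^esub> u \<in> T" if uT: "u \<in> T" for u
    proof -
      obtain a z where u: "a \<in> carrier H" "u = d a \<otimes>\<^bsub>Q\<^esub> x [^]\<^bsub>Q\<^esub> (z::int)" using uT by (auto simp: T_def)
      then have "inv\<^bsub>Q\<^esub> u = d (inv\<^bsub>H\<^esub> a) \<otimes>\<^bsub>Q\<^esub> x [^]\<^bsub>Q\<^esub> (- z)"
        using xQ by (simp add: Q.inv_mult Q.int_pow_neg)
      then show ?thesis using Tmem[of "inv\<^bsub>H\<^esub> a" "- z"] u by simp
    qed
    show "u \<otimes>\<^bsub>Q\<^esub> v \<in> T" if uT: "u \<in> T" "v \<in> T" for u v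
    proof -
      obtain a z where u: "a \<in> carrier H" "u = d a \<otimes>\<^bsub>Q\<^esub> x [^]\<^bsub>Q\<^esub> (z::int)" using uT by (auto simp: T_def)
      obtain b y where v: "b \<in> carrier H" "v = d b \<otimes>\<^bsub>Q\<^esub> x [^]\<^bsub>Q\<^esub> (y::int)" using uT by (auto simp: T_def)
      have "u \<otimes>\<^bsub>Q\<^esub> v = d (a \<otimes>\<^bsub>H\<^esub> b) \<otimes>\<^bsub>Q\<^esub> x [^]\<^bsub>Q\<^esub> (z + y)"
        using u v xQ by (simp add: Q.int_pow_mult Q.m_ac)
      then show ?thesis using Tmem[of "a \<otimes>\<^bsub>H\<^esub> b" "z + y"] u v by simp
    qed
  qed
  define S where "S = {y \<in> carrier Q. \<exists>n>0. y [^]\<^bsub>Q\<^esub> (n::nat) \<in> T}"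
  have root_S: "y \<in> S" if y: "y \<in> carrier Q" "n > 0" "y [^]\<^bsub>Q\<^esub> n \<in> S" for y and n :: nat
  proof -
    obtain k where "k > 0" "(y [^]\<^bsub>Q\<^esub> n) [^]\<^bsub>Q\<^esub> (k::nat) \<in> T" using y by (auto simp: S_def)
    then have "n * k > 0 \<and> y [^]\<^bsub>Q\<^esub> (n * k) \<in> T" using y by (auto simp: Q.nat_pow_pow)
    then show ?thesis unfolding S_def using y(1) by blast
  qed
  have TS: "T \<subseteq> S" using subgroup.subset[OF sT] by (force simp: S_def intro: exI[of _ "1::nat"])
  have powT: "u [^]\<^bsub>Q\<^esub> n \<in> T" if "u \<in> T" for u and n :: nat
    using that sT by (induction n) (auto intro: subgroup.m_closed subgroup.one_closed)
  have sS: "subgroup S Q"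
  proof (rule Q.subgroupI)
    show "S \<noteq> {}" using TS subgroup.one_closed[OF sT] by auto
    show "inv\<^bsub>Q\<^esub> u \<in> S" if "u \<in> S" for u
      using that subgroup.m_inv_closed[OF sT] by (auto simp: S_def Q.nat_pow_inv)
    show "u \<otimes>\<^bsub>Q\<^esub> v \<in> S" if uv: "u \<in> S" "v \<in> S" for u v
    proof -
      obtain k l where "k > 0" "u [^]\<^bsub>Q\<^esub> (k::nat) \<in> T" "l > 0" "v [^]\<^bsub>Q\<^esub> (l::nat) \<in> T"
        using uv by (auto simp: S_def)
      moreover have "(u \<otimes>\<^bsub>Q\<^esub> v) [^]\<^bsub>Q\<^esub> (k * l) = (u [^]\<^bsub>Q\<^esub> k) [^]\<^bsub>Q\<^esub> l \<otimes>\<^bsub>Q\<^esub> (v [^]\<^bsub>Q\<^esub> l) [^]\<^bsub>Q\<^esub> k"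
        using uv by (simp add: S_def Q.nat_pow_distrib Q.nat_pow_pow mult.commute)
      ultimately have "k * l > 0 \<and> (u \<otimes>\<^bsub>Q\<^esub> v) [^]\<^bsub>Q\<^esub> (k * l) \<in> T"
        using powT subgroup.m_closed[OF sT] by auto
      moreover have "u \<otimes>\<^bsub>Q\<^esub> v \<in> carrier Q" using uv by (simp add: S_def)
      ultimately show ?thesis unfolding S_def by blast
    qed
  qed (auto simp: S_def)
  define K where "K = Q\<lparr>carrier := S\<rparr>"
  have K: "torsion_free_group K" unfolding K_def by (rule torsion_free_group_subgroup[OF Q sS])
  have pK: "y [^]\<^bsub>K\<^esub> n = y [^]\<^bsub>Q\<^esub> n" for y and n :: nat
    by (simp add: K_def flip: Q.nat_pow_consistent)
  have mK: "y \<otimes>\<^bsub>K\<^esub> z = y \<otimes>\<^bsub>Q\<^esub> z" for y z by (simp add: K_def)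
  have cK: "carrier K = S" by (simp add: K_def)
  interpret K: comm_group K using K by (simp add: torsion_free_group_def)
  have dS: "d a \<in> S" if "a \<in> carrier H" for a
    using Tmem[OF that, of 0] TS that by auto
  have xS: "x \<in> S" using Tmem[of "\<one>\<^bsub>H\<^esub>" 1] TS xQ by auto
  have "inj_on d (carrier H)"
  proof (rule inj_onI)
    fix a b assume ab: "a \<in> carrier H" "b \<in> carrier H" "d a = d b"
    have "\<forall>\<^sub>F n in sequentially. a = b"
      using iffD1[OF c_eq[OF dP[OF ab(1)] dP[OF ab(2)]] ab(3)[unfolded d_def]] .
    then show "a = b" by simp
  qed
  then have "d \<in> mon H K" using d_hom dS by (auto simp: mon_def hom_def mK cK)
  moreover have "\<exists>z\<in>carrier H. z [^]\<^bsub>H\<^esub> n = a"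
    if a: "a \<in> carrier H" and y: "y \<in> carrier K" "y [^]\<^bsub>K\<^esub> n = d a" for a y and n :: nat
  proof -
    \<comment> \<open>An equation with the class of a constant sequence holds at almost all indices,
      and the coordinate of \<open>v\<close> at any one of them is already a root in
      \<open>H\<close>.\<close>
    obtain v where v: "v \<in> carrier P" "y = c v" 
    proof -
      have "y \<in> c ` carrier P" using y(1) unfolding cK S_def cQ[symmetric] by simp
      then show thesis using that by (elim imageE)
    qed
    have "c (v [^]\<^bsub>P\<^esub> n) = c (\<lambda>_. a)" using y(2) v by (simp add: pK d_def c.hom_nat_pow)
    then have "\<forall>\<^sub>F k in sequentially. v k [^]\<^bsub>H\<^esub> n = a"
      unfolding c_eq[OF P.nat_pow_closed[OF v(1)] dP[OF a]] by (simp add: pP)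
    then obtain k where "v k [^]\<^bsub>H\<^esub> n = a" by (meson eventually_happens sequentially_bot)
    then show ?thesis using v by (auto simp: cP)
  qed
  ultimately have d_pure: "pure_embedding d H K"
    unfolding pure_embedding_iff[OF H.is_group K.is_group] by blast
  show thesis
  proof (rule that)
    show "torsion_free_group K" by fact
    show "|carrier K| \<le>o \<kappa>"
      unfolding cK by (rule card_of_roots_ordLeq[OF Q _ _ T H(3)]) (auto simp: S_def)
    show "pure_embedding d H K" by fact
    show "x \<in> carrier K" using xS cK by simp
    show "\<forall>j. \<exists>w\<in>carrier K. x = d (g j) \<otimes>\<^bsub>K\<^esub> w [^]\<^bsub>K\<^esub> m j"
    proof
      fix j
      obtain w where w: "\<And>n. j \<le> n \<Longrightarrow> w n \<in> carrier H \<and> h n = g j \<otimes>\<^bsub>H\<^esub> w n [^]\<^bsub>H\<^esub> m j"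
        using sol by metis
      \<comment> \<open>The default below \<open>j\<close> only has to lie in \<open>H\<close>,
        because finitely many coordinates do not affect the class.\<close>
      define v where "v n = (if j \<le> n then w n else \<one>\<^bsub>H\<^esub>)" for n
      have v: "v \<in> carrier P" using w by (auto simp: cP v_def)
      have "c h = c ((\<lambda>_. g j) \<otimes>\<^bsub>P\<^esub> v [^]\<^bsub>P\<^esub> m j)"
        using hP v g w by (subst c_eq)
          (auto simp: pP mP cP v_def eventually_sequentially intro!: exI[of _ j])
      then have eq: "x = d (g j) \<otimes>\<^bsub>Q\<^esub> c v [^]\<^bsub>Q\<^esub> m j"
        using v dP[OF g] by (simp add: x_def d_def c.hom_nat_pow)
      \<comment> \<open>The witness must lie in \<open>S\<close> and not merely in \<open>Q\<close>.
        Its power with exponent \<open>m j\<close> does, and \<open>S\<close> is closed under roots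
        of positive exponent.\<close>
      have "c v [^]\<^bsub>Q\<^esub> m j = inv\<^bsub>Q\<^esub> d (g j) \<otimes>\<^bsub>Q\<^esub> x"
        unfolding eq using v g by (simp flip: Q.m_assoc)
      also have "\<dots> \<in> S" using dS[OF g] xS sS by (simp add: subgroup.m_closed subgroup.m_inv_closed)
      finally have "c v \<in> S" using root_S[of "c v" "m j"] v m by simp
      then show "\<exists>w\<in>carrier K. x = d (g j) \<otimes>\<^bsub>K\<^esub> w [^]\<^bsub>K\<^esub> m j"
        using eq by (auto simp: cK mK pK)
    qed
  qed
qed

section \<open>Congruences and countable saturation\<close>

text \<open>For \<open>m = 0\<close> this is equality on the carrier, which lets one spanning
  statement serve both independence modulo a prime and rational independence.\<close>

definition congr :: "('a, 'b) monoid_scheme \<Rightarrow> nat \<Rightarrow> 'a \<Rightarrow> 'a \<Rightarrow> bool"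
  where "congr G m x y \<longleftrightarrow> (\<exists>w\<in>carrier G. y = x \<otimes>\<^bsub>G\<^esub> w [^]\<^bsub>G\<^esub> m)"

section \<open>Calculus of congruences and the Chinese remainder theorem\<close>

context comm_group
begin

lemma congrI: "w \<in> carrier G \<Longrightarrow> y = x \<otimes> w [^] m \<Longrightarrow> congr G m x y"
  by (auto simp: congr_def)

lemma congr_refl: "x \<in> carrier G \<Longrightarrow> congr G m x x"
  by (rule congrI[of \<one>]) auto

lemma congr_sym:
  assumes "x \<in> carrier G" "congr G m x y"
  shows "congr G m y x"
proof -
  obtain w where "w \<in> carrier G" "y = x \<otimes> w [^] m" using assms by (auto simp: congr_def)
  then show ?thesis using assms(1) by (intro congrI[of "inv w"]) (auto simp: nat_pow_inv m_assoc)
qed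

lemma congr_mult:
  assumes "x \<in> carrier G" "x' \<in> carrier G" "congr G m x y" "congr G m x' y'"
  shows "congr G m (x \<otimes> x') (y \<otimes> y')"
proof -
  obtain w w' where "w \<in> carrier G" "y = x \<otimes> w [^] m" "w' \<in> carrier G" "y' = x' \<otimes> w' [^] m"
    using assms by (auto simp: congr_def)
  then show ?thesis using assms(1,2)
    by (intro congrI[of "w \<otimes> w'"]) (auto simp: nat_pow_distrib m_ac)
qed

lemma congr_trans:
  assumes "x \<in> carrier G" "congr G m x y" "congr G m y z"
  shows "congr G m x z"
proof -
  obtain w w' where "w \<in> carrier G" "y = x \<otimes> w [^] m" "w' \<in> carrier G" "z = y \<otimes> w' [^] m"
    using assms by (auto simp: congr_def)
  then show ?thesis using assms(1)
    by (intro congrI[of "w \<otimes> w'"]) (auto simp: nat_pow_distrib m_ac)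
qed

lemma congr_dvd:
  assumes "congr G m x y" "k dvd m"
  shows "congr G k x y"
proof -
  obtain w l where "w \<in> carrier G" "y = x \<otimes> w [^] m" "m = k * l"
    using assms unfolding congr_def dvd_def by blast
  then show ?thesis by (intro congrI[of "w [^] l"]) (auto simp: nat_pow_pow mult.commute)
qed

lemma congr_int_pow:
  assumes "x \<in> carrier G" "int m dvd b - a"
  shows "congr G m (x [^] a) (x [^] b)"
proof -
  obtain c where "b = a + c * int m" using assms(2) by (metis diff_add_cancel add.commute dvdE mult.commute)
  then have "x [^] b = x [^] a \<otimes> (x [^] c) [^] m"
    using assms(1) by (simp add: int_pow_mult int_pow_pow flip: int_pow_int)
  then show ?thesis using assms(1) by (intro congrI) auto
qed

lemma chinese_remainder:
  assumes "finite I" "\<And>i. i \<in> I \<Longrightarrow> g i \<in> carrier G"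
    "\<And>i j. i \<in> I \<Longrightarrow> j \<in> I \<Longrightarrow> i \<noteq> j \<Longrightarrow> coprime (m i :: nat) (m j)"
  shows "\<exists>h\<in>carrier G. \<forall>i\<in>I. congr G (m i) (g i) h"
  using assms
proof (induction I rule: finite_induct)
  case empty
  show ?case by auto
next
  case (insert p I)
  then obtain h where h: "h \<in> carrier G" "\<forall>i\<in>I. congr G (m i) (g i) h" by auto
  define M where "M = (\<Prod>i\<in>I. m i)"
  have "coprime (m p) M"
    unfolding M_def using insert by (intro prod_coprime_right) auto
  then have "coprime (int (m p)) (int M)" by simp
  then obtain u v where uv: "u * int (m p) + v * int M = 1"
    by (metis bezout_int coprime_imp_gcd_eq_1)
  \<comment> \<open>By Bezout the exponent \<open>v * int M\<close> is 1 modulo \<open>m p\<close>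
    and 0 modulo \<open>M\<close>, and \<open>u * int (m p)\<close> is the reverse. So
    \<open>h'\<close> agrees with \<open>g p\<close> modulo \<open>m p\<close> and with
    \<open>h\<close> modulo all earlier moduli.\<close>
  define h' where "h' = g p [^] (v * int M) \<otimes> h [^] (u * int (m p))"
  have gp: "g p \<in> carrier G" using insert by simp
  have "congr G (m p) (g p [^] (1::int) \<otimes> h [^] (0::int)) h'"
    unfolding h'_def
  proof (intro congr_mult congr_int_pow)
    have "v * int M - 1 = int (m p) * - u" using uv by (simp add: algebra_simps)
    then show "int (m p) dvd v * int M - 1" by (metis dvd_triv_left)
  qed (use gp h in auto)
  then have 1: "congr G (m p) (g p) h'" using gp by simp
  have 2: "congr G (m q) (g q) h'" if "q \<in> I" for q
  proof -
    have mq: "int (m q) dvd int M" unfolding M_def using insert(1) that by (auto intro: dvd_prodI)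
    have "congr G (m q) (g p [^] (0::int) \<otimes> h [^] (1::int)) h'"
      unfolding h'_def
    proof (intro congr_mult congr_int_pow)
      have "u * int (m p) - 1 = int M * - v" using uv by (simp add: algebra_simps)
      then show "int (m q) dvd u * int (m p) - 1" using mq by simp
    qed (use gp h mq in auto)
    then have "congr G (m q) h h'" using h by simp
    then show ?thesis using congr_trans[of "g q" "m q" h h'] h insert that by auto
  qed
  show ?case using 1 2 gp h by (intro bexI[of _ h']) (auto simp: h'_def)
qed

end

text \<open>The chain is used only through these properties. \<open>H\<close> and \<open>S\<close>
  stand for two consecutive members, the first containing the given countable set; purity of
  \<open>S\<close> turns pure embeddings into \<open>S\<close> into pure embeddings into
  \<open>G\<close>.\<close>

locale countably_universal =
  fixes \<kappa> :: "'l rel" and G :: "('a, 'b) monoid_scheme" (structure)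
  assumes torsion_free: "torsion_free_group G"
    and card_carrier: "|carrier G| \<le>o \<kappa>" and Cinfinite: "Cinfinite \<kappa>"
    and universal: "\<And>x :: nat \<Rightarrow> 'a. range x \<subseteq> carrier G \<Longrightarrow>
      \<exists>H S. range x \<subseteq> H \<and> pure_subgroup S G \<and> universal_over \<kappa> (G\<lparr>carrier := S\<rparr>) H"
begin

sublocale comm_group G
  using torsion_free by (simp add: torsion_free_group_def)

lemma universal_over_pure_subgroup:
  assumes "pure_subgroup S G" "universal_over \<kappa> (G\<lparr>carrier := S\<rparr>) H"
  shows "pure_subgroup H G" "|H| =o \<kappa>"
proof -
  have S: "subgroup S G" using assms(1) by (simp add: pure_subgroup_def)
  have H: "pure_subgroup H (G\<lparr>carrier := S\<rparr>)" using assms(2) by (simp add: universal_over_def)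
  then have sH: "subgroup H (G\<lparr>carrier := S\<rparr>)" by (simp add: pure_subgroup_def)
  have gS: "group (G\<lparr>carrier := S\<rparr>)" using S by (rule subgroup_imp_group)
  have gH: "group (G\<lparr>carrier := H\<rparr>)" using group.subgroup_imp_group[OF gS sH] by simp
  have "pure_embedding (\<lambda>x. x) (G\<lparr>carrier := H\<rparr>) (G\<lparr>carrier := S\<rparr>)"
    using H pure_embedding_inclusion[where G = "G\<lparr>carrier := S\<rparr>" and H = H] by simp
  then have "pure_embedding (\<lambda>x. x) (G\<lparr>carrier := H\<rparr>) G"
    using pure_embedding_comp[OF gH gS is_group _ pure_embedding_inclusion[THEN iffD2, OF assms(1)], of "\<lambda>x. x"]
    by (simp add: comp_def)
  then show "pure_subgroup H G" by (simp add: pure_embedding_inclusion)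
  show "|H| =o \<kappa>" using assms(2) by (simp add: universal_over_def)
qed

lemma universal_over_pure_embedding:
  fixes K :: "('c, 'd) monoid_scheme"
  assumes "pure_subgroup S G" "universal_over \<kappa> (G\<lparr>carrier := S\<rparr>) H"
    and "torsion_free_group K" "|carrier K| \<le>o \<kappa>" "pure_embedding j (G\<lparr>carrier := H\<rparr>) K"
  obtains f where "pure_embedding f K G" "\<And>x. x \<in> H \<Longrightarrow> f (j x) = x"
proof -
  have S: "subgroup S G" using assms(1) by (simp add: pure_subgroup_def)
  have gS: "group (G\<lparr>carrier := S\<rparr>)" using S by (rule subgroup_imp_group)
  have gK: "group K" using assms(3) by (simp add: torsion_free_group_def comm_group_def)
  obtain f where f: "pure_embedding f K (G\<lparr>carrier := S\<rparr>)" "\<And>x. x \<in> H \<Longrightarrow> f (j x) = x"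
    using universal_over_embedding[OF assms(2-4), of j] assms(5) by auto
  have "pure_embedding f K G"
    using pure_embedding_comp[OF gK gS is_group f(1) pure_embedding_inclusion[THEN iffD2, OF assms(1)]]
    by (simp add: comp_def)
  then show thesis using that f(2) by blast
qed

text \<open>The direct sum of \<open>H\<close> and \<open>M\<close> is a pure extension of
  \<open>H\<close> of cardinality at most \<open>\<kappa>\<close>. Universality embeds it purely in
  \<open>G\<close>, and \<open>M\<close> is a direct summand of it.\<close>

lemma pure_embedding_exists:
  fixes M :: "('c, 'd) monoid_scheme"
  assumes "torsion_free_group M" "|carrier M| \<le>o \<kappa>"
  shows "\<exists>f. pure_embedding f M G"
proof -
  obtain H S where HS: "pure_subgroup S G" "universal_over \<kappa> (G\<lparr>carrier := S\<rparr>) H"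
    using universal[of "\<lambda>_. \<one>"] by auto
  note H = universal_over_pure_subgroup[OF HS]
  have sH: "subgroup H G" using H by (simp add: pure_subgroup_def)
  let ?H = "G\<lparr>carrier := H\<rparr>"
  have tH: "torsion_free_group ?H" by (rule torsion_free_group_subgroup[OF torsion_free sH])
  interpret H: comm_group ?H using tH by (simp add: torsion_free_group_def)
  interpret M: comm_group M using assms by (simp add: torsion_free_group_def)
  define K where "K = ?H \<times>\<times> M"
  have gK: "group K" unfolding K_def by (intro DirProd_group H.is_group M.is_group)
  have pK: "x [^]\<^bsub>K\<^esub> n = (fst x [^]\<^bsub>?H\<^esub> n, snd x [^]\<^bsub>M\<^esub> n)" for x and n :: nat
    by (induction n) (auto simp: K_def mult_DirProd')
  have "comm_group K"
    by (rule group.group_comm_groupI[OF gK]) (auto simp: K_def H.m_comm[simplified] M.m_comm)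
  then have K: "torsion_free_group K"
    using tH assms(1) unfolding torsion_free_group_def pK by (auto simp: K_def)
  have "|carrier K| \<le>o \<kappa>"
    unfolding K_def carrier_DirProd using H(2) assms(2) Cinfinite
    by (intro card_of_Times_ordLeq_infinite_Field) (auto simp: cinfinite_def ordIso_iff_ordLeq)
  moreover have "pure_embedding (\<lambda>x. (x, \<one>\<^bsub>M\<^esub>)) ?H K"
    unfolding pure_embedding_iff[OF H.is_group gK] pK
    by (auto simp: K_def mon_def hom_def inj_on_def)
  ultimately obtain f where f: "pure_embedding f K G"
    using universal_over_pure_embedding[OF HS K] by blast
  have "pure_embedding (\<lambda>x. (\<one>, x)) M K"
    unfolding pure_embedding_iff[OF M.is_group gK] pK
    using subgroup.one_closed[OF sH] by (auto simp: K_def mon_def hom_def inj_on_def)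
  then show ?thesis using pure_embedding_comp[OF M.is_group gK is_group _ f] by blast
qed

lemma solve_congruences:
  fixes g :: "nat \<Rightarrow> 'a" and m :: "nat \<Rightarrow> nat"
  assumes g: "\<And>j. g j \<in> carrier G" and m: "\<And>j. m j > 0"
    and fin: "\<And>n. \<exists>h\<in>carrier G. \<forall>j\<le>n. congr G (m j) (g j) h"
  shows "\<exists>x\<in>carrier G. \<forall>j. congr G (m j) (g j) x"
proof -
  obtain h where h: "\<And>n. h n \<in> carrier G" "\<And>n j. j \<le> n \<Longrightarrow> congr G (m j) (g j) (h n)"
    using fin by metis
  \<comment> \<open>Targets \<open>g\<close> and approximate solutions \<open>h\<close> are
    interleaved, so that one application of \<open>universal\<close> puts both into the same
    \<open>H\<close>.\<close>
  define s where "s n = (if even n then g (n div 2) else h (n div 2))" for n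
  have sg: "s (2 * n) = g n" and sh: "s (2 * n + 1) = h n" for n by (auto simp: s_def)
  have "range s \<subseteq> carrier G" using g h by (auto simp: s_def)
  then obtain H S where HS: "range s \<subseteq> H" "pure_subgroup S G" "universal_over \<kappa> (G\<lparr>carrier := S\<rparr>) H"
    using universal by blast
  note H = universal_over_pure_subgroup[OF HS(2,3)]
  have gH: "g n \<in> H" and hH: "h n \<in> H" for n
    using subsetD[OF HS(1), OF rangeI[of s "2 * n"]] subsetD[OF HS(1), OF rangeI[of s "2 * n + 1"]]
    unfolding sg sh by auto
  have sH: "subgroup H G" using H by (simp add: pure_subgroup_def)
  let ?H = "G\<lparr>carrier := H\<rparr>"
  have tH: "torsion_free_group ?H" by (rule torsion_free_group_subgroup[OF torsion_free sH])
  have sol: "\<exists>w\<in>carrier ?H. h n = g j \<otimes>\<^bsub>?H\<^esub> w [^]\<^bsub>?H\<^esub> m j" if jn: "j \<le> n" for n j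
  proof -
    obtain w where w: "w \<in> carrier G" "h n = g j \<otimes> w [^] m j"
      using h(2)[OF jn] by (auto simp: congr_def)
    \<comment> \<open>The power of \<open>w\<close> is a difference of elements of \<open>H\<close>,
      so purity replaces \<open>w\<close> by a root inside \<open>H\<close>. Finite solvability thus
      passes from \<open>G\<close> down to \<open>H\<close>.\<close>
    then have "w [^] m j = inv (g j) \<otimes> h n" using g by (simp flip: m_assoc)
    also have "\<dots> \<in> H" using gH hH sH by (simp add: subgroup.m_closed subgroup.m_inv_closed)
    finally obtain z where "z \<in> H" "z [^] m j = w [^] m j"
      using H(1) w(1) unfolding pure_subgroup_iff[OF is_group] by blast
    then show ?thesis using w(2) by (intro bexI[of _ z]) (simp_all flip: nat_pow_consistent)
  qed
  have cH: "|carrier ?H| \<le>o \<kappa>" using H(2) by (simp add: ordIso_iff_ordLeq)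
  have gH': "g n \<in> carrier ?H" and hH': "h n \<in> carrier ?H" for n using gH hH by simp_all
  obtain K :: "(nat \<Rightarrow> 'a) set monoid" and d x
    where K: "torsion_free_group K" "|carrier K| \<le>o \<kappa>" "pure_embedding d ?H K" "x \<in> carrier K"
      "\<forall>j. \<exists>w\<in>carrier K. x = d (g j) \<otimes>\<^bsub>K\<^esub> w [^]\<^bsub>K\<^esub> m j"
    by (rule pure_extension_realizing[OF tH cH Cinfinite hH' gH' sol m])
  obtain f where f: "pure_embedding f K G" "\<And>a. a \<in> H \<Longrightarrow> f (d a) = a"
    using universal_over_pure_embedding[OF HS(2,3) K(1-3)] by blast
  interpret f: group_hom K G f
    using f(1) K(1) is_group
    by (simp add: group_hom_def group_hom_axioms_def pure_embedding_def mon_def torsion_free_group_def comm_group_def)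
  have dK: "d a \<in> carrier K" if "a \<in> H" for a
    using K(3) that by (auto simp: pure_embedding_def mon_def hom_def)
  show ?thesis
  proof (intro bexI[of _ "f x"] allI)
    show "f x \<in> carrier G" using K(4) by simp
    fix j
    obtain w where w: "w \<in> carrier K" "x = d (g j) \<otimes>\<^bsub>K\<^esub> w [^]\<^bsub>K\<^esub> m j" using K(5) by blast
    have "f x = g j \<otimes> f w [^] m j"
      unfolding w(2) using w(1) dK[OF gH] f(2)[OF gH] by (simp add: f.hom_nat_pow)
    then show "congr G (m j) (g j) (f x)" using w(1) by (intro congrI[of "f w"]) auto
  qed
qed

lemma solve_padic_systems:
  fixes g :: "nat \<Rightarrow> nat \<Rightarrow> 'a"
  assumes g: "\<And>p n. Factorial_Ring.prime p \<Longrightarrow> g p n \<in> carrier G"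
    and gg: "\<And>p n. Factorial_Ring.prime p \<Longrightarrow> congr G (p ^ n) (g p n) (g p (Suc n))"
  shows "\<exists>x\<in>carrier G. \<forall>p n. Factorial_Ring.prime p \<longrightarrow> congr G (p ^ n) (g p n) x"
proof -
  have mono: "congr G (p ^ n) (g p n) (g p (n + k))" if p: "Factorial_Ring.prime p" for p n k
  proof (induction k)
    case (Suc k)
    have "congr G (p ^ n) (g p (n + k)) (g p (n + Suc k))"
      using congr_dvd[OF gg[OF p, of "n + k"], of "p ^ n"] by (simp add: power_add)
    then show ?case using Suc congr_trans g[OF p] by blast
  qed (use g[OF p] congr_refl in auto)
  \<comment> \<open>A single index enumerates all pairs of base and exponent. A base that is not
    prime gets the modulus 1, for which the congruence is vacuous.\<close>
  define g' where "g' j = (case prod_decode j of (p, n) \<Rightarrow> if Factorial_Ring.prime p then g p n else \<one>)" for j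
  define m where "m j = (case prod_decode j of (p, n) \<Rightarrow> if Factorial_Ring.prime p then p ^ n else 1)" for j
  have "\<exists>x\<in>carrier G. \<forall>j. congr G (m j) (g' j) x"
  proof (rule solve_congruences)
    show "g' j \<in> carrier G" for j using g by (auto simp: g'_def split: prod.split)
    show "m j > 0" for j by (auto simp: m_def prime_gt_0_nat split: prod.split)
    fix N
    \<comment> \<open>Indices up to \<open>N\<close> decode to \<open>p\<close> and \<open>n\<close>
      that are both at most \<open>N\<close>. So it suffices to solve modulo \<open>p ^ N\<close>
      for the primes up to \<open>N\<close>, and these moduli are pairwise coprime.\<close>
    have "\<exists>h\<in>carrier G. \<forall>p\<in>{p. Factorial_Ring.prime p \<and> p \<le> N}. congr G (p ^ N) (g p N) h"
      by (rule chinese_remainder) (auto simp: g primes_coprime)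
    then obtain h where h: "h \<in> carrier G"
      "\<And>p. Factorial_Ring.prime p \<Longrightarrow> p \<le> N \<Longrightarrow> congr G (p ^ N) (g p N) h" by auto
    have "congr G (m j) (g' j) h" if jN: "j \<le> N" for j
    proof -
      obtain p n where pn: "prod_decode j = (p, n)" by fastforce
      then have j: "j = prod_encode (p, n)" by (metis prod_decode_inverse)
      then have "p \<le> N" and n: "n \<le> N"
        using jN le_prod_encode_1[of p n] le_prod_encode_2[of n p] by auto
      show ?thesis
      proof (cases "Factorial_Ring.prime p")
        case True
        have "congr G (p ^ n) (g p N) h"
          using congr_dvd[OF h(2)[OF True \<open>p \<le> N\<close>]] n by (simp add: le_imp_power_dvd)
        moreover have "congr G (p ^ n) (g p n) (g p N)" using mono[OF True, of n "N - n"] n by simp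
        ultimately have "congr G (p ^ n) (g p n) h" using congr_trans g[OF True] by blast
        then show ?thesis using True pn by (simp add: m_def g'_def)
      next
        case False
        then show ?thesis using pn h(1) by (auto simp: m_def g'_def intro: congrI[of h])
      qed
    qed
    then show "\<exists>h\<in>carrier G. \<forall>j\<le>N. congr G (m j) (g' j) h" using h(1) by blast
  qed
  then obtain x where x: "x \<in> carrier G" "\<And>j. congr G (m j) (g' j) x" by blast
  have "congr G (p ^ n) (g p n) x" if "Factorial_Ring.prime p" for p n
    using x(2)[of "prod_encode (p, n)"] that by (simp add: m_def g'_def)
  then show ?thesis using x(1) by blast
qed

end

text \<open>Being shorter than the successor of \<open>\<kappa>\<close>, the chain has at most
  \<open>\<kappa>\<close> members, which bounds the cardinality of its union. A limit ordinal has no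
  last element, so the member that catches a given sequence has a universal successor.\<close>

lemma limit_model_countably_universal:
  fixes \<kappa> :: "'l rel" and \<alpha> :: "'i rel" and G :: "('a, 'b) monoid_scheme"
  assumes Cinf: "Cinfinite \<kappa>" and wo: "Well_order \<alpha>" and lim: "wo_rel.isLimOrd \<alpha>"
    and le: "\<alpha> <o cardSuc \<kappa>" and cof: "cardSuc natLeq \<le>o cofinality \<alpha>"
    and "limit_model \<kappa> \<alpha> G"
  shows "countably_universal \<kappa> G"
proof -
  interpret W: wo_rel \<alpha> using wo by (simp add: wo_rel_def)
  interpret G: comm_group G using assms by (simp add: limit_model_def)
  obtain A :: "'i \<Rightarrow> 'a set" where tA: "\<And>i. i \<in> Field \<alpha> \<Longrightarrow> torsion_free_group (G\<lparr>carrier := A i\<rparr>)"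
    and cA: "\<And>i. i \<in> Field \<alpha> \<Longrightarrow> |A i| =o \<kappa>"
    and pA: "\<And>i j. (i, j) \<in> \<alpha> \<Longrightarrow> i \<noteq> j \<Longrightarrow> pure_subgroup (A i) (G\<lparr>carrier := A j\<rparr>)"
    and uA: "\<And>i. i \<in> Field \<alpha> \<Longrightarrow> aboveS \<alpha> i \<noteq> {} \<Longrightarrow>
          universal_over \<kappa> (G\<lparr>carrier := A (wo_rel.succ \<alpha> i)\<rparr>) (A i)"
    and GA: "carrier G = (\<Union>i\<in>Field \<alpha>. A i)"
    using assms(6) unfolding limit_model_def by metis
  have mono: "A i \<subseteq> A j" if "(i, j) \<in> \<alpha>" for i j
    using pA[OF that] subgroup.subset by (cases "i = j") (fastforce simp: pure_subgroup_def)+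
  have AG: "A i \<subseteq> carrier G" if "i \<in> Field \<alpha>" for i using that GA by blast
  have sA: "subgroup (A i) G" if "i \<in> Field \<alpha>" for i
    using G.group_incl_imp_subgroup[OF AG[OF that]] tA[OF that] by (simp add: torsion_free_group_def comm_group_def)
  have tf: "torsion_free_group G"
    unfolding torsion_free_group_def
  proof (intro conjI ballI allI impI)
    show "comm_group G" by (rule G.comm_group_axioms)
    fix x and n :: nat assume x: "x \<in> carrier G" "n > 0" "x [^]\<^bsub>G\<^esub> n = \<one>\<^bsub>G\<^esub>"
    then obtain i where "i \<in> Field \<alpha>" "x \<in> A i" using GA by blast
    then show "x = \<one>\<^bsub>G\<^esub>"
      using tA[of i] x(2,3) by (simp add: torsion_free_group_def flip: G.nat_pow_consistent)
  qed
  have pureA: "pure_subgroup (A i) G" if i: "i \<in> Field \<alpha>" for i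
    unfolding pure_subgroup_iff[OF G.is_group]
  proof (intro conjI ballI allI impI)
    show "subgroup (A i) G" using sA i by simp
    fix x and n :: nat assume x: "x \<in> carrier G" "x [^]\<^bsub>G\<^esub> n \<in> A i"
    then obtain j where j: "j \<in> Field \<alpha>" "x \<in> A j" using GA by blast
    show "\<exists>y\<in>A i. y [^]\<^bsub>G\<^esub> n = x [^]\<^bsub>G\<^esub> n"
    proof (cases "x \<in> A i")
      case False
      \<comment> \<open>An element outside \<open>A i\<close> can only come from a later member, and
        \<open>A i\<close> is pure in that one.\<close>
      then have "(i, j) \<in> \<alpha>" "i \<noteq> j" using mono j i W.TOTALS by blast+
      then have "pure_subgroup (A i) (G\<lparr>carrier := A j\<rparr>)" by (rule pA)
      moreover have "group (G\<lparr>carrier := A j\<rparr>)" using tA[OF j(1)] by (simp add: torsion_free_group_def comm_group_def)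
      ultimately have "\<forall>x\<in>A j. \<forall>n::nat. x [^]\<^bsub>G\<^esub> n \<in> A i \<longrightarrow> (\<exists>y\<in>A i. y [^]\<^bsub>G\<^esub> n = x [^]\<^bsub>G\<^esub> n)"
        by (simp add: pure_subgroup_iff flip: G.nat_pow_consistent)
      then show ?thesis using j x by blast
    qed auto
  qed
  show ?thesis
  proof
    show "torsion_free_group G" by fact
    show "Cinfinite \<kappa>" by fact
    have "|Field \<alpha>| <o cardSuc \<kappa>"
      using card_of_least[OF wo] le ordLeq_ordLess_trans by blast
    then have "|Field \<alpha>| \<le>o \<kappa>"
      using Cinf card_of_Card_order cardSuc_ordLeq_ordLess by blast
    then show "|carrier G| \<le>o \<kappa>"
      unfolding GA using Cinf cA
      by (intro card_of_UNION_ordLeq_infinite_Field) (auto simp: cinfinite_def ordIso_iff_ordLeq)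
    fix x :: "nat \<Rightarrow> 'a" assume x: "range x \<subseteq> carrier G"
    then have "\<forall>n. \<exists>i\<in>Field \<alpha>. x n \<in> A i" using GA by blast
    then obtain ix where ix: "\<And>n. ix n \<in> Field \<alpha>" "\<And>n. x n \<in> A (ix n)" by metis
    have "\<not> cofinal (range ix) \<alpha>"
    proof
      assume "cofinal (range ix) \<alpha>"
      then have 1: "cofinality \<alpha> \<le>o |range ix|"
        using is_cofinality_cofinality[OF wo lim] ix(1) unfolding is_cofinality_def by (metis image_subsetI)
      have 2: "|range ix| \<le>o natLeq"
        using card_of_image[of ix UNIV] card_of_nat ordLeq_ordIso_trans by blast
      have "cardSuc natLeq \<le>o natLeq" by (rule ordLeq_transitive[OF ordLeq_transitive[OF cof 1] 2])
      then show False using cardSuc_greater[OF natLeq_Card_order] not_ordLess_ordLeq by blast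
    qed
    \<comment> \<open>Failure of cofinality yields an \<open>a\<close> that is not strictly below
      any \<open>ix n\<close>; in a linear order it is then an upper bound of all of them.\<close>
    then obtain a where a: "a \<in> Field \<alpha>" "\<And>n. a = ix n \<or> (a, ix n) \<notin> \<alpha>"
      unfolding cofinal_def by blast
    have "x n \<in> A a" for n
      using a(2)[of n] a(1) ix[of n] mono W.TOTALS by blast
    then have "range x \<subseteq> A a" by auto
    moreover have ab: "aboveS \<alpha> a \<noteq> {}" using W.isLimOrd_aboveS[OF lim a(1)] .
    ultimately show "\<exists>H S. range x \<subseteq> H \<and> pure_subgroup S G \<and> universal_over \<kappa> (G\<lparr>carrier := S\<rparr>) H"
      using uA[OF a(1)] pureA[OF W.succ_in_Field[OF ab]] by blast
  qed
qed

section \<open>Linear independence\<close>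

text \<open>\<open>frag_extend (frag_of \<circ> s)\<close> renames each generator \<open>i\<close>
  to \<open>s i\<close>. Injectivity of \<open>s\<close> prevents terms from merging.\<close>

lemma lookup_frag_extend_frag_of:
  assumes "inj_on s I" "Poly_Mapping.keys k \<subseteq> I" "i \<in> I"
  shows "Poly_Mapping.lookup (frag_extend (frag_of \<circ> s) k) (s i) = Poly_Mapping.lookup k i"
  using assms(2)
proof (induction k rule: frag_induction)
  case (one j)
  then show ?case using assms(1,3) by (auto simp: inj_on_def)
qed (auto simp: frag_extend_diff lookup_minus)

lemma keys_frag_extend_frag_of: "Poly_Mapping.keys (frag_extend (frag_of \<circ> s) k) \<subseteq> s ` Poly_Mapping.keys k"
  using keys_frag_extend[of "frag_of \<circ> s" k] by auto

lemma frag_extend_frag_of_surj: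
  assumes "Poly_Mapping.keys k \<subseteq> s ` I"
  obtains k' where "Poly_Mapping.keys k' \<subseteq> I" "frag_extend (frag_of \<circ> s) k' = k"
proof
  define k' where "k' = frag_extend (frag_of \<circ> inv_into I s) k"
  show "Poly_Mapping.keys k' \<subseteq> I"
    using keys_frag_extend_frag_of[of "inv_into I s" k] assms inv_into_into[of _ s I] unfolding k'_def by blast
  have "frag_extend (frag_of \<circ> s) k' = frag_extend (frag_of \<circ> s \<circ> inv_into I s) k"
    unfolding k'_def by (rule frag_extend_compose)
  also have "\<dots> = frag_extend frag_of k"
    by (rule frag_extend_eq) (use assms in \<open>auto simp: f_inv_into_f\<close>)
  finally show "frag_extend (frag_of \<circ> s) k' = k" by (simp flip: frag_expansion)
qed

context comm_group
begin

lemma hom_free_Abelian_group_eqI: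
  assumes "f \<in> hom (free_Abelian_group I) G" "h \<in> hom (free_Abelian_group I) G"
    and "\<And>i. i \<in> I \<Longrightarrow> f (frag_of i) = h (frag_of i)" and "Poly_Mapping.keys k \<subseteq> I"
  shows "f k = h k"
proof -
  interpret f: group_hom "free_Abelian_group I" G f
    using assms(1) by (simp add: group_hom_def group_hom_axioms_def)
  interpret h: group_hom "free_Abelian_group I" G h
    using assms(2) by (simp add: group_hom_def group_hom_axioms_def)
  show ?thesis
  proof (rule free_Abelian_group_induct[OF assms(4)])
    show "f 0 = h 0" using f.hom_one h.hom_one by simp
    fix x y assume xy: "Poly_Mapping.keys x \<subseteq> I" "Poly_Mapping.keys y \<subseteq> I" "f x = h x" "f y = h y"
    then have c: "x \<in> carrier (free_Abelian_group I)" "y \<in> carrier (free_Abelian_group I)" by simp_all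
    have "f (x \<otimes>\<^bsub>free_Abelian_group I\<^esub> inv\<^bsub>free_Abelian_group I\<^esub> y)
        = h (x \<otimes>\<^bsub>free_Abelian_group I\<^esub> inv\<^bsub>free_Abelian_group I\<^esub> y)"
      using f.hom_mult[OF c(1) f.G.inv_closed[OF c(2)]] h.hom_mult[OF c(1) f.G.inv_closed[OF c(2)]]
        f.hom_inv[OF c(2)] h.hom_inv[OF c(2)] xy(3,4) by (simp only:)
    then show "f (x - y) = h (x - y)" using xy by simp
  qed (rule assms(3))
qed

text \<open>The counit of the free abelian group on the set \<open>carrier G\<close>. Since the
  generators are the elements of \<open>G\<close> themselves, independence becomes a property of
  sets, as Zorn's lemma requires.\<close>

definition free_eval :: "('a \<Rightarrow>\<^sub>0 int) \<Rightarrow> 'a"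
  where "free_eval = (SOME h. h \<in> hom (free_Abelian_group (carrier G)) G \<and>
    (\<forall>x\<in>carrier G. h (frag_of x) = x))"

lemma free_eval_hom: "free_eval \<in> hom (free_Abelian_group (carrier G)) G"
  and free_eval_frag_of [simp]: "x \<in> carrier G \<Longrightarrow> free_eval (frag_of x) = x"
proof -
  have "\<exists>h. h \<in> hom (free_Abelian_group (carrier G)) G \<and> (\<forall>x\<in>carrier G. h (frag_of x) = x)"
    by (rule free_Abelian_group_universal[of "\<lambda>x. x" "carrier G"]) auto
  from someI_ex[OF this] show "free_eval \<in> hom (free_Abelian_group (carrier G)) G"
    "x \<in> carrier G \<Longrightarrow> free_eval (frag_of x) = x"
    by (auto simp: free_eval_def)
qed

lemma free_eval_closed [simp]: "Poly_Mapping.keys k \<subseteq> carrier G \<Longrightarrow> free_eval k \<in> carrier G"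
  using hom_in_carrier[OF free_eval_hom, of k] by simp

lemma free_eval_0 [simp]: "free_eval 0 = \<one>"
  using hom_one[OF free_eval_hom group_free_Abelian_group is_group] by simp

lemma free_eval_add:
  "Poly_Mapping.keys k \<subseteq> carrier G \<Longrightarrow> Poly_Mapping.keys l \<subseteq> carrier G \<Longrightarrow>
    free_eval (k + l) = free_eval k \<otimes> free_eval l"
  using hom_mult[OF free_eval_hom, of k l] by simp

lemma free_eval_frag_cmul:
  "Poly_Mapping.keys k \<subseteq> carrier G \<Longrightarrow> free_eval (frag_cmul z k) = free_eval k [^] z"
  using hom_int_pow[OF free_eval_hom _ group_free_Abelian_group is_group, of k z] by simp

lemma free_eval_frag_extend_hom:
  assumes "s ` I \<subseteq> carrier G"
  shows "(\<lambda>k. free_eval (frag_extend (frag_of \<circ> s) k)) \<in> hom (free_Abelian_group I) G"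
proof -
  have "Poly_Mapping.keys (frag_extend (frag_of \<circ> s) k) \<subseteq> carrier G" if "Poly_Mapping.keys k \<subseteq> I" for k
    using keys_frag_extend_frag_of[of s k] assms that by blast
  then show ?thesis by (intro homI) (auto simp: frag_extend_add free_eval_add)
qed

text \<open>
  For a prime \<open>p\<close> this is linear independence modulo \<open>p G\<close> over the field with \<open>p\<close> elements; for
  \<open>p = 0\<close>, where \<open>multiples G 0\<close> is trivial and \<open>0 dvd z\<close> means \<open>z = 0\<close>, it is linear
  independence over the integers.
\<close>

definition indep :: "nat \<Rightarrow> 'a set \<Rightarrow> bool"
  where "indep p B \<longleftrightarrow> (\<forall>k. Poly_Mapping.keys k \<subseteq> B \<longrightarrow> free_eval k \<in> multiples G p \<longrightarrow>
    (\<forall>b. int p dvd Poly_Mapping.lookup k b))"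

lemma one_in_multiples: "\<one> \<in> multiples G n"
  unfolding multiples_def by (rule image_eqI[of _ _ \<one>]) auto

text \<open>Turns an independent family, given by a homomorphism on a free group, into an
  independent set that can be enlarged. A repetition in the family would give a relation with
  coefficient 1, which only \<open>p = 1\<close> would allow.\<close>

lemma indep_image_frag_of:
  assumes f: "f \<in> hom (free_Abelian_group I) G" and p: "p \<noteq> 1"
    and ind: "\<And>k i. Poly_Mapping.keys k \<subseteq> I \<Longrightarrow> f k \<in> multiples G p \<Longrightarrow> int p dvd Poly_Mapping.lookup k i"
  shows "inj_on (f \<circ> frag_of) I" "indep p ((f \<circ> frag_of) ` I)"
proof -
  interpret f: group_hom "free_Abelian_group I" G f
    using f by (simp add: group_hom_def group_hom_axioms_def)
  define g where "g = f \<circ> frag_of"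
  have gG: "g i \<in> carrier G" if "i \<in> I" for i using that f.hom_closed[of "frag_of i"] by (simp add: g_def)
  show inj: "inj_on (f \<circ> frag_of) I"
  proof (rule inj_onI, rule ccontr)
    fix i j assume ij: "i \<in> I" "j \<in> I" "(f \<circ> frag_of) i = (f \<circ> frag_of) j" "i \<noteq> j"
    let ?k = "frag_of i \<otimes>\<^bsub>free_Abelian_group I\<^esub> inv\<^bsub>free_Abelian_group I\<^esub> (frag_of j)"
    have "f ?k = \<one>"
      using ij gG[OF ij(1)] gG[OF ij(2)]
      by (subst f.hom_mult, simp, simp) (subst f.hom_inv, auto simp: g_def)
    then have "f (frag_of i - frag_of j) \<in> multiples G p" using ij one_in_multiples by simp
    moreover have "Poly_Mapping.keys (frag_of i - frag_of j) \<subseteq> I"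
      using keys_diff[of "frag_of i" "frag_of j"] ij by auto
    ultimately have "int p dvd Poly_Mapping.lookup (frag_of i - frag_of j) i" using ind by blast
    then show False using ij p by (simp add: lookup_minus)
  qed
  show "indep p ((f \<circ> frag_of) ` I)"
    unfolding indep_def g_def[symmetric]
  proof (intro allI impI)
    fix k b assume k: "Poly_Mapping.keys k \<subseteq> g ` I" "free_eval k \<in> multiples G p"
    obtain k' where k': "Poly_Mapping.keys k' \<subseteq> I" and k'k: "frag_extend (frag_of \<circ> g) k' = k"
      using frag_extend_frag_of_surj[OF k(1)] .
    have "f k' = free_eval (frag_extend (frag_of \<circ> g) k')"
      by (rule hom_free_Abelian_group_eqI[OF f free_eval_frag_extend_hom _ k'])
        (use gG in \<open>auto simp: g_def\<close>)
    then have d: "int p dvd Poly_Mapping.lookup k' i" for i using ind k' k k'k by simp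
    show "int p dvd Poly_Mapping.lookup k b"
    proof (cases "b \<in> g ` I")
      case True
      then obtain i where "i \<in> I" "b = g i" by blast
      then show ?thesis
        using lookup_frag_extend_frag_of[OF inj k'] d[of i] k'k by (simp add: g_def)
    next
      case False
      then show ?thesis using k(1) by (metis dvd_0_right in_keys_iff subsetD)
    qed
  qed
qed

text \<open>The way back from sets to families: enumerating independent elements by \<open>s\<close>
  gives a map on the free group that is injective modulo \<open>p\<close>.\<close>

lemma indep_frag_extend:
  assumes "indep p B" "inj_on s I" "s ` I \<subseteq> B" "Poly_Mapping.keys k \<subseteq> I"
    "free_eval (frag_extend (frag_of \<circ> s) k) \<in> multiples G p"
  shows "int p dvd Poly_Mapping.lookup k i"
proof (cases "i \<in> I")
  case True
  have "Poly_Mapping.keys (frag_extend (frag_of \<circ> s) k) \<subseteq> B"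
    using keys_frag_extend_frag_of[of s k] assms(3,4) by blast
  then have "int p dvd Poly_Mapping.lookup (frag_extend (frag_of \<circ> s) k) (s i)"
    using assms(1,5) by (simp add: indep_def)
  then show ?thesis using lookup_frag_extend_frag_of[OF assms(2,4) True] by simp
next
  case False
  then show ?thesis using assms(4) by (metis dvd_0_right in_keys_iff subsetD)
qed

text \<open>Adding \<open>x\<close> to a maximal \<open>B\<close> creates a relation in which the
  coefficient of \<open>x\<close> is not divisible by \<open>p\<close>; solving for that term gives
  \<open>m\<close> and \<open>k\<close>. The factor \<open>m\<close> stays because for
  \<open>p = 0\<close> it cannot be inverted. Maximality is taken inside \<open>X\<close>, so that
  the divisible part gets a basis of its own.\<close>

lemma maximal_indep_exists:
  assumes E: "indep p E" "E \<subseteq> X" and X: "X \<subseteq> carrier G" and p: "p \<noteq> 1"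
  obtains B where "E \<subseteq> B" "B \<subseteq> X" "indep p B"
    "\<forall>x\<in>X. \<exists>m k. \<not> int p dvd m \<and> Poly_Mapping.keys k \<subseteq> B \<and> congr G p (free_eval k) (x [^] (m::int))"
proof -
  define \<A> where "\<A> = {B. E \<subseteq> B \<and> B \<subseteq> X \<and> indep p B}"
  have "\<exists>M\<in>\<A>. \<forall>B\<in>\<A>. M \<subseteq> B \<longrightarrow> B = M"
  proof (rule subset_Zorn_nonempty)
    show "\<A> \<noteq> {}" using E by (auto simp: \<A>_def)
    fix C assume C: "C \<noteq> {}" "subset.chain \<A> C"
    then have CA: "C \<subseteq> \<A>" by (simp add: subset.chain_def)
    have "indep p (\<Union>C)"
      unfolding indep_def
    proof (intro allI impI)
      fix k b assume k: "Poly_Mapping.keys k \<subseteq> \<Union>C" "free_eval k \<in> multiples G p"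
      obtain B where "B \<in> C" "Poly_Mapping.keys k \<subseteq> B"
        using finite_subset_Union_chain[OF _ k(1) C] by auto
      moreover have "indep p B" using \<open>B \<in> C\<close> CA by (auto simp: \<A>_def)
      ultimately show "int p dvd Poly_Mapping.lookup k b" using k by (auto simp: indep_def)
    qed
    moreover have "E \<subseteq> \<Union>C" "\<Union>C \<subseteq> X" using C(1) CA by (auto simp: \<A>_def)
    ultimately show "\<Union>C \<in> \<A>" by (simp add: \<A>_def)
  qed
  then obtain B where B: "E \<subseteq> B" "B \<subseteq> X" "indep p B"
    and max: "\<And>B'. E \<subseteq> B' \<Longrightarrow> B' \<subseteq> X \<Longrightarrow> indep p B' \<Longrightarrow> B \<subseteq> B' \<Longrightarrow> B' = B"
    by (auto simp: \<A>_def)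
  have "\<exists>m k. \<not> int p dvd m \<and> Poly_Mapping.keys k \<subseteq> B \<and> congr G p (free_eval k) (x [^] (m::int))"
    if x: "x \<in> X" for x
  proof (cases "x \<in> B")
    case True
    have "congr G p (free_eval (frag_of x)) (x [^] (1::int))"
      using subsetD[OF X x] by (simp add: congr_refl)
    then show ?thesis using True p by (intro exI[of _ 1] exI[of _ "frag_of x"]) auto
  next
    case False
    have xG: "x \<in> carrier G" and BG: "B \<subseteq> carrier G" using x X B by auto
    have "\<not> indep p (insert x B)"
      using max[of "insert x B"] False B x by auto
    then obtain k b where k: "Poly_Mapping.keys k \<subseteq> insert x B" "free_eval k \<in> multiples G p"
      "\<not> int p dvd Poly_Mapping.lookup k b"
      by (auto simp: indep_def)
    define c where "c = Poly_Mapping.lookup k x"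
    define k' where "k' = k + frag_cmul (- c) (frag_of x)"
    have lk': "Poly_Mapping.lookup k' y = (if y = x then 0 else Poly_Mapping.lookup k y)" for y
      by (auto simp: k'_def lookup_add c_def)
    have k'B: "Poly_Mapping.keys k' \<subseteq> B"
      using k(1) lk' by (force simp: in_keys_iff subset_iff split: if_splits)
    obtain w where w: "w \<in> carrier G" "free_eval k = w [^] p" using k(2) by (auto simp: multiples_def)
    have "Poly_Mapping.keys k \<subseteq> carrier G" using k(1) xG BG by auto
    then have ek': "free_eval k' = w [^] p \<otimes> x [^] (- c)"
      unfolding k'_def using xG w by (subst free_eval_add) (auto simp: free_eval_frag_cmul keys_cmul_iff)
    \<comment> \<open>Otherwise the term of \<open>x\<close> lies in \<open>multiples G p\<close>
      and can be absorbed into \<open>w\<close>. This leaves a relation over \<open>B\<close>, whose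
      coefficients are then all divisible by \<open>p\<close>, contrary to the choice of
      \<open>b\<close>.\<close>
    have "\<not> int p dvd c"
    proof
      assume "int p dvd c"
      then obtain d where d: "c = d * int p" by (metis dvdE mult.commute)
      have "x [^] (- c) = (x [^] (- d)) [^] p"
        using xG by (simp add: d int_pow_pow flip: int_pow_int)
      then have "free_eval k' = (w \<otimes> x [^] (- d)) [^] p"
        using ek' w xG by (simp add: nat_pow_distrib)
      then have "free_eval k' \<in> multiples G p" using w xG by (auto simp: multiples_def)
      then have "int p dvd Poly_Mapping.lookup k' y" for y using B(3) k'B by (auto simp: indep_def)
      from this[of b] have "b \<noteq> x \<Longrightarrow> int p dvd Poly_Mapping.lookup k b" by (simp add: lk')
      then show False using k(3) \<open>int p dvd c\<close> by (auto simp: c_def)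
    qed
    moreover have "x [^] (- c) = free_eval k' \<otimes> (inv w) [^] p"
      using ek' w xG by (simp add: nat_pow_inv m_comm[of "w [^] p"] m_assoc)
    then have "congr G p (free_eval k') (x [^] (- c))"
      using w by (intro congrI[of "inv w"]) auto
    ultimately show ?thesis using k'B by (intro exI[of _ "- c"] exI[of _ k']) auto
  qed
  then show thesis using that B by blast
qed

end

section \<open>Direct sums of subgroups of the rationals\<close>

lemma exists_frag_lookup:
  assumes "finite J"
  shows "\<exists>k. Poly_Mapping.keys k \<subseteq> J \<and> (\<forall>i\<in>J. Poly_Mapping.lookup k i = (f i :: int))"
proof -
  have fin: "finite {i. (if i \<in> J then f i else 0) \<noteq> 0}"
    using assms by (rule rev_finite_subset) auto
  obtain k where k: "Poly_Mapping.lookup k = (\<lambda>i. if i \<in> J then f i else 0)"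
    by (rule that[OF lookup_Abs_poly_mapping[OF fin]])
  have "Poly_Mapping.keys k \<subseteq> J"
  proof
    fix i assume "i \<in> Poly_Mapping.keys k"
    then show "i \<in> J" unfolding in_keys_iff k by (simp split: if_splits)
  qed
  then show ?thesis using k by (intro exI[of _ k]) simp
qed

lemma common_denominator:
  assumes "finite J"
  shows "\<exists>m>0. \<forall>i\<in>J. of_nat m * (x i :: rat) \<in> \<int>"
  using assms
proof (induction J rule: finite_induct)
  case empty
  show ?case by (auto intro: exI[of _ 1])
next
  case (insert j J)
  then obtain m where m: "m > 0" "\<forall>i\<in>J. of_nat m * x i \<in> \<int>" by blast
  obtain a b where ab: "x j = of_int a / of_int b" "b > 0"
    by (cases "x j") (auto simp: Fract_of_int_quotient)
  have "of_nat (m * nat b) * x i \<in> \<int>" if "i \<in> insert j J" for i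
  proof (cases "i = j")
    case True
    have "of_nat (m * nat b) * x i = of_int (int m * a)" using ab True by simp
    then show ?thesis by (metis Ints_of_int)
  next
    case False
    then have "of_nat m * x i \<in> \<int>" using m that by auto
    then have "of_nat (nat b) * (of_nat m * x i) \<in> \<int>" by (rule Ints_mult[OF Ints_of_nat])
    then show ?thesis by (simp add: ac_simps)
  qed
  then show ?case using m(1) ab(2) by (intro exI[of _ "m * nat b"]) auto
qed

section \<open>The rationals and the localized integers\<close>

lemma rat_group_simps [simp]:
  "carrier rat_group = UNIV" "x \<otimes>\<^bsub>rat_group\<^esub> y = x + y" "\<one>\<^bsub>rat_group\<^esub> = 0"
  by (simp_all add: rat_group_def)

lemma comm_group_rat_group: "comm_group rat_group"
  by (rule comm_groupI) (auto intro: exI[of _ "- x" for x])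

lemma carrier_localized_int_group:
  "carrier (localized_int_group p) = {of_int n / of_int m | n m :: int. m \<noteq> 0 \<and> coprime m (int p)}"
  by (simp add: localized_int_group_def)

lemma localized_int_group_eq: "localized_int_group p = rat_group\<lparr>carrier := carrier (localized_int_group p)\<rparr>"
  by (simp add: localized_int_group_def)

lemma subgroup_localized_int_group: "subgroup (carrier (localized_int_group p)) rat_group"
proof -
  interpret comm_group rat_group by (rule comm_group_rat_group)
  have inv: "inv\<^bsub>rat_group\<^esub> x = - x" for x by (rule inv_equality) auto
  show ?thesis
  proof (rule subgroupI)
    show "carrier (localized_int_group p) \<noteq> {}"
      by (auto simp: carrier_localized_int_group intro!: exI[of _ 1])
    fix a assume "a \<in> carrier (localized_int_group p)"
    then obtain n m where a: "a = of_int n / of_int m" "m \<noteq> 0" "coprime m (int p)"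
      by (auto simp: carrier_localized_int_group)
    then have "- a = of_int (- n) / of_int m" by simp
    then show "inv\<^bsub>rat_group\<^esub> a \<in> carrier (localized_int_group p)"
      unfolding inv carrier_localized_int_group using a by blast
    fix b assume "b \<in> carrier (localized_int_group p)"
    then obtain n' m' where b: "b = of_int n' / of_int m'" "m' \<noteq> 0" "coprime m' (int p)"
      by (auto simp: carrier_localized_int_group)
    have "a + b = of_int (n * m' + n' * m) / of_int (m * m')"
      using a b by (simp add: field_simps)
    moreover have "m * m' \<noteq> 0" "coprime (m * m') (int p)" using a b by auto
    ultimately show "a \<otimes>\<^bsub>rat_group\<^esub> b \<in> carrier (localized_int_group p)"
      unfolding carrier_localized_int_group rat_group_simps by blast
  qed auto
qed

lemma of_int_in_localized_int_group: "of_int z \<in> carrier (localized_int_group p)"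
  unfolding carrier_localized_int_group mem_Collect_eq by (rule exI[of _ z], rule exI[of _ 1]) simp

lemma localized_int_group_dvd:
  assumes "w \<in> carrier (localized_int_group p)" "of_int z = of_nat p * w"
  shows "int p dvd z"
proof -
  obtain n m where w: "w = of_int n / of_int m" "m \<noteq> 0" "coprime m (int p)"
    using assms(1) by (auto simp: carrier_localized_int_group)
  then have "rat_of_int (z * m) = rat_of_int (int p * n)" using assms(2) by (simp add: field_simps)
  then have "z * m = int p * n" by (simp only: of_int_eq_iff)
  then have "int p dvd z * m" by simp
  then show ?thesis using w(3) by (simp add: coprime_commute coprime_dvd_mult_left_iff)
qed

lemma localized_int_group_residue:
  assumes "r \<in> carrier (localized_int_group p)"
  shows "\<exists>k. \<exists>w\<in>carrier (localized_int_group p). r = of_int k + of_nat p * w"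
proof -
  obtain n m where r: "r = of_int n / of_int m" "m \<noteq> 0" "coprime m (int p)"
    using assms by (auto simp: carrier_localized_int_group)
  obtain u v where "u * m + v * int p = 1"
    using r(3) by (metis bezout_int coprime_imp_gcd_eq_1)
  then have "of_int u * of_int m + of_int v * of_nat p = (1::rat)"
    by (metis of_int_1 of_int_add of_int_mult of_int_of_nat_eq)
  \<comment> \<open>Multiplying \<open>n / m\<close> by the Bezout identity splits off the integer
    \<open>n * u\<close>, because the factor \<open>m\<close> cancels the denominator; the rest is a
    multiple of \<open>p\<close>.\<close>
  then have "r = r * (of_int u * of_int m + of_int v * of_nat p)" by simp
  also have "\<dots> = of_int (n * u) + of_nat p * (of_int (v * n) / of_int m)"
    using r(2) by (simp add: r(1) field_simps)
  finally show ?thesis using r(2,3) unfolding carrier_localized_int_group by blast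
qed

text \<open>The inclusion of a direct sum of copies of the integers, represented by formal
  combinations, into a direct sum of rationals; \<open>int_vec I (frag_of i)\<close> is a unit
  vector for \<open>i\<close> in \<open>I\<close>.\<close>

definition int_vec :: "'i set \<Rightarrow> ('i \<Rightarrow>\<^sub>0 int) \<Rightarrow> 'i \<Rightarrow> rat"
  where "int_vec I k = (\<lambda>i\<in>I. of_int (Poly_Mapping.lookup k i))"

text \<open>Treats sums of copies of the rationals and of the localized integers together.
  Containing the integers makes \<open>int_vec\<close> map into the sum.\<close>

locale rat_subgroup =
  fixes S :: "rat set" and I :: "'i set"
  assumes sub: "subgroup S rat_group" and Ints: "\<int> \<subseteq> S"
begin

abbreviation A where "A \<equiv> sum_group I (\<lambda>_. rat_group\<lparr>carrier := S\<rparr>)"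

lemma group_S: "group (rat_group\<lparr>carrier := S\<rparr>)"
  using group.subgroup_imp_group[OF comm_group.axioms(2)[OF comm_group_rat_group] sub] .

lemma carrier_A: "carrier A = {x \<in> I \<rightarrow>\<^sub>E S. finite {i \<in> I. x i \<noteq> 0}}"
  by (subst carrier_sum_group) (auto simp: group_S)

lemma mult_A: "x \<otimes>\<^bsub>A\<^esub> y = (\<lambda>i\<in>I. x i + y i)"
  by simp

lemma one_A: "\<one>\<^bsub>A\<^esub> = (\<lambda>i\<in>I. 0)"
  by simp

lemma pow_A: "x \<in> carrier A \<Longrightarrow> x [^]\<^bsub>A\<^esub> (n::nat) = (\<lambda>i\<in>I. of_nat n * x i)"
  by (induction n) (auto simp: one_A mult_A algebra_simps)

lemma torsion_free_A: "torsion_free_group A"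
proof -
  have "group A" using group_S by simp
  then have "comm_group A"
    by (rule group.group_comm_groupI) (auto simp: mult_A add.commute)
  moreover have "x = \<one>\<^bsub>A\<^esub>" if x: "x \<in> carrier A" "n > 0" "x [^]\<^bsub>A\<^esub> n = \<one>\<^bsub>A\<^esub>" for x and n :: nat
  proof
    fix i
    have "(\<lambda>i\<in>I. of_nat n * x i) i = (\<lambda>i\<in>I. 0) i" using x pow_A one_A by metis
    then show "x i = \<one>\<^bsub>A\<^esub> i" using x(1,2) by (auto simp: one_A carrier_A PiE_iff extensional_def split: if_splits)
  qed
  ultimately show ?thesis by (simp add: torsion_free_group_def)
qed

lemma int_vec_closed: "Poly_Mapping.keys k \<subseteq> I \<Longrightarrow> int_vec I k \<in> carrier A"
  using Ints by (auto simp: carrier_A int_vec_def in_keys_iff simp flip: in_keys_iff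
      intro: finite_subset[OF _ finite_keys[of k]])

lemma int_vec_hom: "int_vec I \<in> hom (free_Abelian_group I) A"
proof (rule homI)
  show "int_vec I k \<in> carrier A" if "k \<in> carrier (free_Abelian_group I)" for k
    using int_vec_closed that by simp
qed (auto simp: mult_A int_vec_def lookup_add)

end

lemma rat_subgroup_UNIV: "rat_subgroup UNIV"
  by unfold_locales (use group.subgroup_self[OF comm_group.axioms(2)[OF comm_group_rat_group]] in auto)

lemma rat_subgroup_localized: "rat_subgroup (carrier (localized_int_group p))"
  by (rule rat_subgroup.intro[OF subgroup_localized_int_group])
    (use of_int_in_localized_int_group in \<open>auto elim!: Ints_cases\<close>)

lemma sum_rat_common_denominator:
  assumes "x \<in> carrier (sum_group I (\<lambda>_. rat_group))"
  shows "\<exists>m>0. \<exists>k. Poly_Mapping.keys k \<subseteq> I \<and> (\<forall>i\<in>I. of_nat m * x i = of_int (Poly_Mapping.lookup k i))"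
proof -
  interpret Q: rat_subgroup UNIV I
    by (rule rat_subgroup_UNIV)
  have Q: "sum_group I (\<lambda>_. rat_group\<lparr>carrier := UNIV\<rparr>) = sum_group I (\<lambda>_. rat_group)"
    by (simp add: rat_group_def)
  define J where "J = {i \<in> I. x i \<noteq> 0}"
  have J: "finite J" using assms Q.carrier_A unfolding Q by (simp add: J_def)
  obtain m where m: "m > 0" "\<forall>i\<in>J. of_nat m * x i \<in> \<int>" using common_denominator[OF J] by blast
  obtain k where k: "Poly_Mapping.keys k \<subseteq> J" "\<forall>i\<in>J. Poly_Mapping.lookup k i = \<lfloor>of_nat m * x i\<rfloor>"
    using exists_frag_lookup[OF J, of "\<lambda>i. \<lfloor>of_nat m * x i\<rfloor>"] by blast
  have "of_nat m * x i = of_int (Poly_Mapping.lookup k i)" if "i \<in> I" for i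
  proof (cases "i \<in> J")
    case True
    then show ?thesis using m(2) k(2) by (auto elim!: Ints_cases)
  next
    case False
    then have "x i = 0" "Poly_Mapping.lookup k i = 0" using that k(1) by (auto simp: J_def in_keys_iff)
    then show ?thesis by simp
  qed
  then show ?thesis using m(1) k(1) by (auto simp: J_def)
qed

text \<open>Vectors have finite support and hence a positive multiple with integer entries, so the
  direct sum consists of roots of the image of a free abelian group of cardinality
  \<open>\<kappa>\<close>.\<close>

lemma card_of_sum_rat:
  fixes \<kappa> :: "'l rel"
  assumes "Cinfinite \<kappa>"
  shows "|carrier (sum_group (Field \<kappa>) (\<lambda>_. rat_group))| \<le>o \<kappa>"
proof -
  let ?I = "Field \<kappa>"
  interpret Q: rat_subgroup UNIV ?I
    by (rule rat_subgroup_UNIV)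
  have Q: "sum_group ?I (\<lambda>_. rat_group\<lparr>carrier := UNIV\<rparr>) = sum_group ?I (\<lambda>_. rat_group)"
    by (simp add: rat_group_def)
  have "|int_vec ?I ` carrier (free_Abelian_group ?I)| \<le>o |carrier (free_Abelian_group ?I)|" by (rule card_of_image)
  also have "|carrier (free_Abelian_group ?I)| =o |?I|"
    using eqpoll_free_Abelian_group_infinite[of ?I] assms
    by (simp add: eqpoll_iff_card_of_ordIso cinfinite_def)
  also have "|?I| =o \<kappa>" using assms card_of_Field_ordIso by blast
  finally have T: "|int_vec ?I ` carrier (free_Abelian_group ?I)| \<le>o \<kappa>" .
  show ?thesis
  proof (rule card_of_roots_ordLeq[OF Q.torsion_free_A[unfolded Q] subset_refl _ T assms])
    fix x assume x: "x \<in> carrier (sum_group ?I (\<lambda>_. rat_group))"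
    obtain m k where mk: "m > 0" "Poly_Mapping.keys k \<subseteq> ?I"
      "\<forall>i\<in>?I. of_nat m * x i = of_int (Poly_Mapping.lookup k i)"
      using sum_rat_common_denominator[OF x] by blast
    have "x [^]\<^bsub>sum_group ?I (\<lambda>_. rat_group)\<^esub> m = int_vec ?I k"
      using Q.pow_A[of x m] x mk(3) unfolding Q int_vec_def by (auto intro: restrict_ext)
    moreover have "int_vec ?I k \<in> int_vec ?I ` carrier (free_Abelian_group ?I)" using mk(2) by simp
    ultimately show "\<exists>m>0::nat. x [^]\<^bsub>sum_group ?I (\<lambda>_. rat_group)\<^esub> m \<in> int_vec ?I ` carrier (free_Abelian_group ?I)"
      using mk(1) by auto
  qed
qed

lemma card_of_sum_localized:
  assumes "Cinfinite \<kappa>"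
  shows "|carrier (sum_group (Field \<kappa>) (\<lambda>_. localized_int_group p))| \<le>o \<kappa>"
proof -
  have "group rat_group" by (rule comm_group.axioms(2)[OF comm_group_rat_group])
  moreover have "group (localized_int_group p)"
    using group.subgroup_imp_group[OF calculation subgroup_localized_int_group[of p]]
    by (simp flip: localized_int_group_eq)
  ultimately have "carrier (sum_group (Field \<kappa>) (\<lambda>_. localized_int_group p)) \<subseteq> carrier (sum_group (Field \<kappa>) (\<lambda>_. rat_group))"
    by (auto simp: carrier_sum_group PiE_iff localized_int_group_def)
  from ordLeq_transitive[OF card_of_mono1[OF this] card_of_sum_rat[OF assms]] show ?thesis .
qed

text \<open>The last two claims express that the inclusion of the sum of integers is injective and
  surjective modulo \<open>p\<close>. They are what \<open>residue_iso\<close> asks for.\<close>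

lemma sum_localized:
  fixes I :: "'i set" and p :: nat
  defines "A \<equiv> sum_group I (\<lambda>_. localized_int_group p)"
  shows torsion_free_sum_localized: "torsion_free_group A"
    and int_vec_hom_sum_localized: "int_vec I \<in> hom (free_Abelian_group I) A"
    and int_vec_dvd: "\<And>k i. Poly_Mapping.keys k \<subseteq> I \<Longrightarrow> int_vec I k \<in> multiples A p \<Longrightarrow>
      int p dvd Poly_Mapping.lookup k i"
    and int_vec_congr: "\<And>x. x \<in> carrier A \<Longrightarrow> \<exists>k. Poly_Mapping.keys k \<subseteq> I \<and> congr A p (int_vec I k) x"
proof -
  let ?S = "carrier (localized_int_group p)"
  interpret rat_subgroup ?S I
    by (rule rat_subgroup_localized)
  have A: "sum_group I (\<lambda>_. rat_group\<lparr>carrier := ?S\<rparr>) = A"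
    by (simp add: A_def flip: localized_int_group_eq)
  note carrier = carrier_A[unfolded A] and mult = mult_A[unfolded A] and pow = pow_A[unfolded A]
  show "torsion_free_group A" "int_vec I \<in> hom (free_Abelian_group I) A"
    using torsion_free_A int_vec_hom unfolding A .
  show "int p dvd Poly_Mapping.lookup k i" if k: "Poly_Mapping.keys k \<subseteq> I" "int_vec I k \<in> multiples A p" for k i
  proof (cases "i \<in> I")
    case True
    obtain w where w: "w \<in> carrier A" "int_vec I k = w [^]\<^bsub>A\<^esub> p" using k(2) by (auto simp: multiples_def)
    have "int_vec I k i = of_nat p * w i" using w True by (simp add: pow)
    moreover have "w i \<in> ?S" using w(1) True by (auto simp: carrier)
    ultimately show ?thesis using localized_int_group_dvd True by (simp add: int_vec_def)
  next
    case False
    then show ?thesis using k(1) by (metis dvd_0_right in_keys_iff subsetD)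
  qed
  show "\<exists>k. Poly_Mapping.keys k \<subseteq> I \<and> congr A p (int_vec I k) x" if x: "x \<in> carrier A" for x
  proof -
    define J where "J = {i \<in> I. x i \<noteq> 0}"
    have J: "finite J" "J \<subseteq> I" using x by (auto simp: carrier J_def)
    have "\<forall>i\<in>I. \<exists>k. \<exists>w\<in>?S. x i = of_int k + of_nat p * w"
      using x localized_int_group_residue by (auto simp: carrier PiE_iff)
    then obtain K W where KW: "\<And>i. i \<in> I \<Longrightarrow> W i \<in> ?S \<and> x i = of_int (K i) + of_nat p * W i"
      by metis
    obtain k where k: "Poly_Mapping.keys k \<subseteq> J" "\<forall>i\<in>J. Poly_Mapping.lookup k i = K i"
      using exists_frag_lookup[OF J(1), of K] by blast
    \<comment> \<open>Outside the support the equation for \<open>x i = 0\<close> may have been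
      solved with nonzero \<open>K i\<close> and \<open>W i\<close>; both are replaced by 0 there to
      keep the support finite.\<close>
    define w where "w = (\<lambda>i\<in>I. if i \<in> J then W i else 0)"
    have "w \<in> carrier A"
      using KW J of_int_in_localized_int_group[of 0 p]
      by (auto simp: carrier w_def intro: finite_subset[OF _ J(1)] split: if_splits)
    moreover have "x = int_vec I k \<otimes>\<^bsub>A\<^esub> w [^]\<^bsub>A\<^esub> p"
    proof
      fix i
      show "x i = (int_vec I k \<otimes>\<^bsub>A\<^esub> w [^]\<^bsub>A\<^esub> p) i"
      proof (cases "i \<in> I")
        case True
        have "x i = of_int (Poly_Mapping.lookup k i) + of_nat p * w i"
        proof (cases "i \<in> J")
          case True
          then show ?thesis using KW J(2) k(2) by (auto simp: w_def)
        next
          case False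
          then have "Poly_Mapping.lookup k i = 0" using k(1) by (auto simp: in_keys_iff)
          then show ?thesis using False True by (simp add: w_def J_def)
        qed
        then show ?thesis using True \<open>w \<in> carrier A\<close> by (simp add: mult pow int_vec_def)
      next
        case False
        then show ?thesis using x by (auto simp: mult carrier PiE_iff extensional_def)
      qed
    qed
    ultimately have "congr A p (int_vec I k) x" by (auto simp: congr_def)
    then show ?thesis using k(1) J(2) by blast
  qed
qed

section \<open>Comparison with the p-adic completion\<close>

context comm_group
begin

lemma congr_iff_multiples:
  assumes "x \<in> carrier G" "y \<in> carrier G"
  shows "congr G m x y \<longleftrightarrow> inv x \<otimes> y \<in> multiples G m"
proof
  assume "congr G m x y"
  then obtain w where "w \<in> carrier G" "y = x \<otimes> w [^] m" by (auto simp: congr_def)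
  then show "inv x \<otimes> y \<in> multiples G m" using assms(1) by (simp add: multiples_def flip: m_assoc)
next
  assume "inv x \<otimes> y \<in> multiples G m"
  then obtain w where w: "w \<in> carrier G" "inv x \<otimes> y = w [^] m" by (auto simp: multiples_def)
  then have "y = x \<otimes> w [^] m" using assms by (simp add: inv_solve_left' flip: w(2) m_assoc)
  then show "congr G m x y" using w(1) by (rule congrI[rotated])
qed

lemma subgroup_multiples: "subgroup (multiples G m) G"
proof (rule subgroupI)
  show "multiples G m \<noteq> {}" using one_in_multiples by auto
  show "inv a \<in> multiples G m" if "a \<in> multiples G m" for a
    using that by (auto simp: multiples_def simp flip: nat_pow_inv)
  show "a \<otimes> b \<in> multiples G m" if "a \<in> multiples G m" "b \<in> multiples G m" for a b
    using that by (auto simp: multiples_def simp flip: nat_pow_distrib)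
qed (auto simp: multiples_def)

lemma r_coset_multiples: "x \<in> carrier G \<Longrightarrow> multiples G m #> x = {a. congr G m x a}"
  by (auto simp: r_coset_def multiples_def congr_def m_comm)

end

lemma congr_hom:
  assumes "h \<in> hom F A" "group F" "group A" "k \<in> carrier F" "congr F m k k'"
  shows "congr A m (h k) (h k')"
proof -
  obtain w where w: "w \<in> carrier F" "k' = k \<otimes>\<^bsub>F\<^esub> w [^]\<^bsub>F\<^esub> m" using assms(5) by (auto simp: congr_def)
  have "h k' = h k \<otimes>\<^bsub>A\<^esub> h w [^]\<^bsub>A\<^esub> m"
    using w assms(4) hom_mult[OF assms(1), of k "w [^]\<^bsub>F\<^esub> m"] hom_nat_pow[OF assms(1) w(1) assms(2,3)]
      monoid.nat_pow_closed[OF group.is_monoid[OF assms(2)] w(1)] by simp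
  then show ?thesis using hom_in_carrier[OF assms(1) w(1)] by (auto simp: congr_def)
qed

text \<open>\<open>\<mu>\<close> induces an isomorphism of \<open>F / p F\<close> with
  \<open>G / p G\<close>. Only this first level is assumed, since torsion-freeness of
  \<open>G\<close> yields all the others. \<open>F\<close> will be free abelian, a common source for
  two groups to be compared.\<close>

locale residue_iso =
  fixes F :: "('f, 'x) monoid_scheme" and G :: "('a, 'b) monoid_scheme" and p :: nat and \<mu>
  assumes F: "comm_group F" and G: "torsion_free_group G" and p: "p > 0" and hom: "\<mu> \<in> hom F G"
    and inj: "\<And>k. k \<in> carrier F \<Longrightarrow> \<mu> k \<in> multiples G p \<Longrightarrow> k \<in> multiples F p"
    and surj: "\<And>g. g \<in> carrier G \<Longrightarrow> \<exists>k\<in>carrier F. congr G p (\<mu> k) g"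
begin

sublocale F: comm_group F by (rule F)
sublocale G: comm_group G using G by (simp add: torsion_free_group_def)
sublocale \<mu>: group_hom F G \<mu> by (simp add: group_hom_def group_hom_axioms_def hom)

text \<open>The first level writes \<open>k\<close> as \<open>l [^] p\<close>; cancelling the
  exponent \<open>p\<close> in the torsion-free \<open>G\<close> leaves \<open>\<mu> l\<close>
  divisible by \<open>p ^ n\<close>, to which the induction hypothesis applies.\<close>

lemma inj_power: "k \<in> carrier F \<Longrightarrow> \<mu> k \<in> multiples G (p ^ n) \<Longrightarrow> k \<in> multiples F (p ^ n)"
proof (induction n arbitrary: k)
  case 0
  then show ?case by (auto simp: multiples_def)
next
  case (Suc n)
  obtain w where w: "w \<in> carrier G" "\<mu> k = w [^]\<^bsub>G\<^esub> (p ^ Suc n)" using Suc.prems by (auto simp: multiples_def)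
  then have eq: "\<mu> k = (w [^]\<^bsub>G\<^esub> (p ^ n)) [^]\<^bsub>G\<^esub> p" by (simp add: G.nat_pow_pow mult.commute)
  then have "\<mu> k \<in> multiples G p" unfolding multiples_def using w(1) by blast
  then obtain l where l: "l \<in> carrier F" "k = l [^]\<^bsub>F\<^esub> p" using inj Suc.prems by (auto simp: multiples_def)
  then have "\<mu> l [^]\<^bsub>G\<^esub> p = (w [^]\<^bsub>G\<^esub> (p ^ n)) [^]\<^bsub>G\<^esub> p" using eq by (simp add: \<mu>.hom_nat_pow)
  then have "\<mu> l = w [^]\<^bsub>G\<^esub> (p ^ n)"
    by (rule torsion_free_group_pow_inject[OF G \<mu>.hom_closed[OF l(1)] G.nat_pow_closed[OF w(1)] p])
  then have "l \<in> multiples F (p ^ n)" using Suc.IH[OF l(1)] w(1) by (auto simp: multiples_def)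
  then obtain v where "v \<in> carrier F" "l = v [^]\<^bsub>F\<^esub> (p ^ n)" by (auto simp: multiples_def)
  then have "v \<in> carrier F" "k = v [^]\<^bsub>F\<^esub> (p ^ Suc n)" using l(2) by (simp_all add: F.nat_pow_pow mult.commute)
  then show ?case unfolding multiples_def by blast
qed

text \<open>Successive approximation: the error modulo \<open>p\<close> is the \<open>p\<close>-th
  power of some \<open>w\<close>, and \<open>w\<close> is approximated in turn.\<close>

lemma surj_power: "g \<in> carrier G \<Longrightarrow> \<exists>k\<in>carrier F. congr G (p ^ n) (\<mu> k) g"
proof (induction n arbitrary: g)
  case 0
  then show ?case by (auto intro!: bexI[of _ "\<one>\<^bsub>F\<^esub>"] simp: congr_def)
next
  case (Suc n)
  obtain k w where k: "k \<in> carrier F" "w \<in> carrier G" "g = \<mu> k \<otimes>\<^bsub>G\<^esub> w [^]\<^bsub>G\<^esub> p"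
    using surj[OF Suc.prems] by (auto simp: congr_def)
  obtain l v where l: "l \<in> carrier F" "v \<in> carrier G" "w = \<mu> l \<otimes>\<^bsub>G\<^esub> v [^]\<^bsub>G\<^esub> (p ^ n)"
    using Suc.IH[OF k(2)] by (auto simp: congr_def)
  have "g = \<mu> (k \<otimes>\<^bsub>F\<^esub> l [^]\<^bsub>F\<^esub> p) \<otimes>\<^bsub>G\<^esub> v [^]\<^bsub>G\<^esub> (p ^ Suc n)"
    using k l by (simp add: \<mu>.hom_nat_pow G.nat_pow_distrib G.nat_pow_pow G.m_assoc mult.commute)
  then show ?case using k(1) l(1,2) by (auto simp: congr_def intro!: bexI[of _ "k \<otimes>\<^bsub>F\<^esub> l [^]\<^bsub>F\<^esub> p"])
qed

lemma congr_reflect: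
  assumes "k \<in> carrier F" "k' \<in> carrier F" "congr G (p ^ n) (\<mu> k) (\<mu> k')"
  shows "congr F (p ^ n) k k'"
  using assms inj_power[of "inv\<^bsub>F\<^esub> k \<otimes>\<^bsub>F\<^esub> k'" n] by (simp add: F.congr_iff_multiples G.congr_iff_multiples)

end

locale same_residues = G: residue_iso F G p \<mu> + A: residue_iso F A p \<epsilon>
  for F :: "('f, 'x) monoid_scheme" and G :: "('a, 'b) monoid_scheme" and A :: "('c, 'd) monoid_scheme" and p \<mu> \<epsilon>
begin

text \<open>At level \<open>n\<close> this is the inverse of the isomorphism
  \<open>F / p ^ n F \<rightarrow> G / p ^ n G\<close> followed by the one onto
  \<open>A / p ^ n A\<close>. Written as a relation it needs no choice of a representative
  \<open>k\<close>.\<close>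

definition to_completion :: "'a \<Rightarrow> nat \<Rightarrow> 'c set"
  where "to_completion g = (\<lambda>n. {a. \<exists>k\<in>carrier F. congr G (p ^ n) (\<mu> k) g \<and> congr A (p ^ n) (\<epsilon> k) a})"

text \<open>Two representatives of \<open>g\<close> are congruent in \<open>F\<close> by
  \<open>congr_reflect\<close>, hence so are their images in \<open>A\<close>; any one of them
  computes the coset.\<close>

lemma to_completion_eq:
  assumes "k \<in> carrier F" "g \<in> carrier G" "congr G (p ^ n) (\<mu> k) g"
  shows "to_completion g n = {a. congr A (p ^ n) (\<epsilon> k) a}"
proof
  show "{a. congr A (p ^ n) (\<epsilon> k) a} \<subseteq> to_completion g n"
    using assms by (auto simp: to_completion_def)
  show "to_completion g n \<subseteq> {a. congr A (p ^ n) (\<epsilon> k) a}"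
  proof
    fix a assume "a \<in> to_completion g n"
    then obtain k' where k': "k' \<in> carrier F" "congr G (p ^ n) (\<mu> k') g" "congr A (p ^ n) (\<epsilon> k') a"
      by (auto simp: to_completion_def)
    have "congr G (p ^ n) (\<mu> k) (\<mu> k')"
      using G.G.congr_trans[OF _ assms(3) G.G.congr_sym[OF _ k'(2)]] assms(1) k'(1) by simp
    then have "congr F (p ^ n) k k'" using G.congr_reflect assms(1) k'(1) by blast
    then have "congr A (p ^ n) (\<epsilon> k) (\<epsilon> k')"
      using congr_hom[OF A.hom G.F.is_group A.G.is_group assms(1)] by blast
    then show "a \<in> {a. congr A (p ^ n) (\<epsilon> k) a}"
      using A.G.congr_trans[OF _ _ k'(3)] assms(1) by auto
  qed
qed

lemma carrier_padic_completion:
  "carrier (padic_completion p A) = {x. (\<forall>n. x n \<in> carrier (A Mod multiples A (p ^ n))) \<and> (\<forall>n. x (Suc n) \<subseteq> x n)}"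
  by (auto simp: padic_completion_def Let_def PiE_iff)

lemma mult_padic_completion: "x \<otimes>\<^bsub>padic_completion p A\<^esub> y = (\<lambda>n. x n <#>\<^bsub>A\<^esub> y n)"
  by (simp add: padic_completion_def Let_def restrict_def)

lemma to_completion_hom: "to_completion \<in> hom G (padic_completion p A)"
proof (rule homI)
  fix g assume g: "g \<in> carrier G"
  have "to_completion g n \<in> carrier (A Mod multiples A (p ^ n))" for n
  proof -
    obtain k where k: "k \<in> carrier F" "congr G (p ^ n) (\<mu> k) g" using G.surj_power[OF g] by blast
    have "to_completion g n = multiples A (p ^ n) #>\<^bsub>A\<^esub> \<epsilon> k"
      using to_completion_eq[OF k(1) g k(2)] A.G.r_coset_multiples k(1) by simp
    then show ?thesis using k(1) by (simp add: carrier_FactGroup)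
  qed
  moreover have "to_completion g (Suc n) \<subseteq> to_completion g n" for n
  proof -
    have d: "p ^ n dvd p ^ Suc n" by simp
    show ?thesis using G.G.congr_dvd[OF _ d] A.G.congr_dvd[OF _ d] unfolding to_completion_def by blast
  qed
  ultimately show "to_completion g \<in> carrier (padic_completion p A)" by (simp add: carrier_padic_completion)
next
  fix g g' assume g: "g \<in> carrier G" "g' \<in> carrier G"
  have "to_completion (g \<otimes>\<^bsub>G\<^esub> g') n = to_completion g n <#>\<^bsub>A\<^esub> to_completion g' n" for n
  proof -
    interpret N: normal "multiples A (p ^ n)" A
      by (rule A.G.subgroup_imp_normal[OF A.G.subgroup_multiples])
    obtain k where k: "k \<in> carrier F" "congr G (p ^ n) (\<mu> k) g" using G.surj_power[OF g(1)] by blast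
    obtain k' where k': "k' \<in> carrier F" "congr G (p ^ n) (\<mu> k') g'" using G.surj_power[OF g(2)] by blast
    have "congr G (p ^ n) (\<mu> (k \<otimes>\<^bsub>F\<^esub> k')) (g \<otimes>\<^bsub>G\<^esub> g')"
      using G.G.congr_mult[OF _ _ k(2) k'(2)] k(1) k'(1) by simp
    then have "to_completion (g \<otimes>\<^bsub>G\<^esub> g') n = multiples A (p ^ n) #>\<^bsub>A\<^esub> \<epsilon> (k \<otimes>\<^bsub>F\<^esub> k')"
      using to_completion_eq[of "k \<otimes>\<^bsub>F\<^esub> k'"] A.G.r_coset_multiples k(1) k'(1) g by simp
    also have "\<dots> = (multiples A (p ^ n) #>\<^bsub>A\<^esub> \<epsilon> k) <#>\<^bsub>A\<^esub> (multiples A (p ^ n) #>\<^bsub>A\<^esub> \<epsilon> k')"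
      using k(1) k'(1) by (simp add: N.rcos_sum)
    finally show ?thesis
      using to_completion_eq[OF k(1) g(1) k(2)] to_completion_eq[OF k'(1) g(2) k'(2)]
        A.G.r_coset_multiples k(1) k'(1) by simp
  qed
  then show "to_completion (g \<otimes>\<^bsub>G\<^esub> g') = to_completion g \<otimes>\<^bsub>padic_completion p A\<^esub> to_completion g'"
    by (auto simp: mult_padic_completion)
qed

text \<open>In particular, the kernel consists of the elements divisible by every power of
  \<open>p\<close>.\<close>

lemma to_completion_eq_iff:
  assumes g: "g \<in> carrier G" "g' \<in> carrier G"
  shows "to_completion g = to_completion g' \<longleftrightarrow> (\<forall>n. congr G (p ^ n) g g')"
proof
  assume eq: "to_completion g = to_completion g'"
  show "\<forall>n. congr G (p ^ n) g g'"
  proof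
    fix n
    obtain k where k: "k \<in> carrier F" "congr G (p ^ n) (\<mu> k) g" using G.surj_power[OF g(1)] by blast
    then have "\<epsilon> k \<in> to_completion g n"
      using A.G.congr_refl by (auto simp: to_completion_def)
    then obtain k' where k': "k' \<in> carrier F" "congr G (p ^ n) (\<mu> k') g'" "congr A (p ^ n) (\<epsilon> k') (\<epsilon> k)"
      unfolding eq by (auto simp: to_completion_def)
    have "congr F (p ^ n) k' k" using A.congr_reflect k(1) k'(1,3) by blast
    then have "congr G (p ^ n) (\<mu> k') (\<mu> k)"
      by (rule congr_hom[OF G.hom G.F.is_group G.G.is_group k'(1)])
    then have "congr G (p ^ n) (\<mu> k') g"
      by (rule G.G.congr_trans[OF G.\<mu>.hom_closed[OF k'(1)] _ k(2)])
    then show "congr G (p ^ n) g g'"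
      by (rule G.G.congr_trans[OF g(1) G.G.congr_sym[OF G.\<mu>.hom_closed[OF k'(1)]] k'(2)])
  qed
next
  assume c: "\<forall>n. congr G (p ^ n) g g'"
  show "to_completion g = to_completion g'"
  proof
    fix n
    obtain k where k: "k \<in> carrier F" "congr G (p ^ n) (\<mu> k) g" using G.surj_power[OF g(1)] by blast
    have "congr G (p ^ n) (\<mu> k) g'"
      using G.G.congr_trans[OF G.\<mu>.hom_closed[OF k(1)] k(2)] c by blast
    then show "to_completion g n = to_completion g' n"
      using to_completion_eq[OF k(1) g(1) k(2)] to_completion_eq[OF k(1) g(2)] by simp
  qed
qed

text \<open>A preimage of \<open>y\<close> is only described, by a coherent system of congruences,
  because the systems of all primes have to be solved by one and the same element.\<close>

lemma to_completion_approx: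
  assumes "y \<in> carrier (padic_completion p A)"
  shows "\<exists>g. (\<forall>n. g n \<in> carrier G) \<and> (\<forall>n. congr G (p ^ n) (g n) (g (Suc n))) \<and>
    (\<forall>x\<in>carrier G. (\<forall>n. congr G (p ^ n) (g n) x) \<longrightarrow> to_completion x = y)"
proof -
  have "\<exists>k\<in>carrier F. y n = {a. congr A (p ^ n) (\<epsilon> k) a}" for n
  proof -
    obtain a where a: "a \<in> carrier A" "y n = multiples A (p ^ n) #>\<^bsub>A\<^esub> a"
    proof -
      have "y n \<in> carrier (A Mod multiples A (p ^ n))" using assms by (simp add: carrier_padic_completion)
      then show thesis using that unfolding carrier_FactGroup by blast
    qed
    obtain k where k: "k \<in> carrier F" "congr A (p ^ n) (\<epsilon> k) a" using A.surj_power[OF a(1)] by blast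
    have "congr A (p ^ n) a b \<longleftrightarrow> congr A (p ^ n) (\<epsilon> k) b" for b
      using A.G.congr_trans[OF _ k(2)] A.G.congr_trans[OF a(1) A.G.congr_sym[OF _ k(2)]] k(1) by auto
    then show ?thesis using a k(1) A.G.r_coset_multiples[OF a(1)] by auto
  qed
  then obtain k where k: "\<And>n. k n \<in> carrier F" "\<And>n. y n = {a. congr A (p ^ n) (\<epsilon> (k n)) a}" by metis
  have "congr G (p ^ n) (\<mu> (k n)) (\<mu> (k (Suc n)))" for n
  proof -
    have "\<epsilon> (k (Suc n)) \<in> y (Suc n)" using k A.G.congr_refl by simp
    then have "\<epsilon> (k (Suc n)) \<in> y n" using assms by (auto simp: carrier_padic_completion)
    then have "congr F (p ^ n) (k n) (k (Suc n))" using k A.congr_reflect by auto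
    then show ?thesis using congr_hom[OF G.hom G.F.is_group G.G.is_group k(1)] by blast
  qed
  moreover have "to_completion x = y" if "x \<in> carrier G" "\<forall>n. congr G (p ^ n) (\<mu> (k n)) x" for x
    by (rule ext) (use to_completion_eq[OF k(1) that(1)] that(2) k(2) in blast)
  ultimately show ?thesis using k(1) by (intro exI[of _ "\<lambda>n. \<mu> (k n)"]) auto
qed

end

section \<open>The decomposition of limit models\<close>

lemma multiples_free_Abelian_groupI:
  assumes "Poly_Mapping.keys k \<subseteq> I" "\<And>i. int p dvd Poly_Mapping.lookup k i"
  shows "k \<in> multiples (free_Abelian_group I) p"
proof -
  obtain l where l: "Poly_Mapping.keys l \<subseteq> Poly_Mapping.keys k"
    "\<forall>i\<in>Poly_Mapping.keys k. Poly_Mapping.lookup l i = Poly_Mapping.lookup k i div int p"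
    using exists_frag_lookup[OF finite_keys[of k], of "\<lambda>i. Poly_Mapping.lookup k i div int p"] by blast
  have "frag_cmul (int p) l = k"
  proof (rule poly_mapping_eqI)
    fix i
    show "Poly_Mapping.lookup (frag_cmul (int p) l) i = Poly_Mapping.lookup k i"
    proof (cases "i \<in> Poly_Mapping.keys k")
      case True
      then show ?thesis using l(2) assms(2)[of i] by simp
    next
      case False
      then have "Poly_Mapping.lookup k i = 0" "Poly_Mapping.lookup l i = 0" using l(1) by (auto simp: in_keys_iff)
      then show ?thesis by simp
    qed
  qed
  then have "k = l [^]\<^bsub>free_Abelian_group I\<^esub> p" by simp
  moreover have "l \<in> carrier (free_Abelian_group I)" using l(1) assms(1) by simp
  ultimately show ?thesis unfolding multiples_def by blast
qed

lemma residue_iso_sum_localized: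
  assumes "p > 0"
  shows "residue_iso (free_Abelian_group I) (sum_group I (\<lambda>_. localized_int_group p)) p (int_vec I)"
proof (rule residue_iso.intro)
  show "k \<in> multiples (free_Abelian_group I) p"
    if "k \<in> carrier (free_Abelian_group I)" "int_vec I k \<in> multiples (sum_group I (\<lambda>_. localized_int_group p)) p" for k
    using that int_vec_dvd by (intro multiples_free_Abelian_groupI) auto
  show "\<exists>k\<in>carrier (free_Abelian_group I). congr (sum_group I (\<lambda>_. localized_int_group p)) p (int_vec I k) g"
    if "g \<in> carrier (sum_group I (\<lambda>_. localized_int_group p))" for g
    using int_vec_congr[OF that] by auto
qed (use assms torsion_free_sum_localized int_vec_hom_sum_localized abelian_free_Abelian_group in auto)

section \<open>Divisibility at all primes\<close>

context comm_group
begin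

lemma multiples_coprime:
  assumes "x \<in> multiples G m" "x \<in> multiples G k" "coprime m k"
  shows "x \<in> multiples G (m * k)"
proof -
  obtain a b where a: "a \<in> carrier G" "x = a [^] m" and b: "b \<in> carrier G" "x = b [^] k"
    using assms by (auto simp: multiples_def)
  have "coprime (int m) (int k)" using assms(3) by simp
  then obtain u v where uv: "u * int m + v * int k = 1"
    by (metis bezout_int coprime_imp_gcd_eq_1)
  \<comment> \<open>In additive terms \<open>x = u m x + v k x\<close>. Writing \<open>x\<close> as
    \<open>k b\<close> in the first summand and as \<open>m a\<close> in the second makes both
    multiples of \<open>m k\<close>.\<close>
  have "x = x [^] (u * int m + v * int k)" using a uv by simp
  also have "\<dots> = x [^] (int k * v) \<otimes> x [^] (int m * u)" using a by (simp add: int_pow_mult m_comm mult.commute)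
  also have "x [^] (int k * v) = (a [^] v) [^] (m * k)"
    using a by (simp add: int_pow_pow ac_simps flip: int_pow_int)
  also have "x [^] (int m * u) = (b [^] u) [^] (m * k)"
    using b by (simp add: int_pow_pow ac_simps flip: int_pow_int)
  also have "(a [^] v) [^] (m * k) \<otimes> (b [^] u) [^] (m * k) = (a [^] v \<otimes> b [^] u) [^] (m * k)"
    using a b by (simp add: nat_pow_distrib)
  finally show ?thesis using a(1) b(1) unfolding multiples_def by blast
qed

text \<open>This identifies the common kernel of the maps to the completions with the divisible
  part.\<close>

lemma multiples_prime_powers:
  assumes x: "x \<in> carrier G" "\<And>p e. Factorial_Ring.prime p \<Longrightarrow> x \<in> multiples G (p ^ e)" and n: "n > 0"
  shows "x \<in> multiples G n"
proof -
  have prod: "x \<in> multiples G (\<Prod>p\<in>P. p ^ e p)" if "finite P" "\<forall>p\<in>P. Factorial_Ring.prime p" for P and e :: "nat \<Rightarrow> nat"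
    using that
  proof (induction P rule: finite_induct)
    case empty
    show ?case using x(1) by (auto simp: multiples_def)
  next
    case (insert p P)
    have "coprime (p ^ e p) (\<Prod>q\<in>P. q ^ e q)"
      using insert by (intro prod_coprime_right) (metis coprime_power_left_iff coprime_power_right_iff insertCI primes_coprime)
    then show ?case using insert x(2) by (simp add: multiples_coprime)
  qed
  have "\<forall>p\<in>prime_factors n. Factorial_Ring.prime p" by (simp add: in_prime_factors_imp_prime)
  then have "x \<in> multiples G (\<Prod>p\<in>prime_factors n. p ^ multiplicity p n)"
    by (rule prod[OF finite_set_mset])
  then show ?thesis using prod_prime_factors[of n] n by simp
qed

end

section \<open>Bases modulo primes, rational coordinates and the isomorphism\<close>

context countably_universal
begin

abbreviation "I \<equiv> Field \<kappa>"

text \<open>Used for prime \<open>p\<close> with \<open>X\<close> the whole carrier, and for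
  \<open>p = 0\<close> with \<open>X\<close> the divisible part. Enumerating the maximal set by
  \<open>I\<close> lets the free group and the target sums share their index set.\<close>

lemma indep_family_exists:
  assumes f: "f \<in> hom (free_Abelian_group I) G" and p: "p \<noteq> 1" and X: "X \<subseteq> carrier G"
    and ind: "\<And>k i. Poly_Mapping.keys k \<subseteq> I \<Longrightarrow> f k \<in> multiples G p \<Longrightarrow> int p dvd Poly_Mapping.lookup k i"
    and fX: "\<And>i. i \<in> I \<Longrightarrow> f (frag_of i) \<in> X"
  obtains s where "inj_on s I" "s ` I \<subseteq> X" "indep p (s ` I)"
    "\<forall>x\<in>X. \<exists>m k. \<not> int p dvd m \<and> Poly_Mapping.keys k \<subseteq> s ` I \<and> congr G p (free_eval k) (x [^] (m::int))"
proof -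
  let ?E = "(f \<circ> frag_of) ` I"
  have E: "inj_on (f \<circ> frag_of) I" "indep p ?E" using indep_image_frag_of[OF f p ind] by auto
  have EX: "?E \<subseteq> X" using fX by auto
  obtain B where B: "?E \<subseteq> B" "B \<subseteq> X" "indep p B"
    "\<forall>x\<in>X. \<exists>m k. \<not> int p dvd m \<and> Poly_Mapping.keys k \<subseteq> B \<and> congr G p (free_eval k) (x [^] (m::int))"
    using maximal_indep_exists[OF E(2) EX X p] .
  have "|I| \<le>o |B|" by (rule card_of_ordLeqI[OF E(1)]) (use B(1) in auto)
  moreover have "|B| \<le>o \<kappa>"
    using card_of_mono1[OF order_trans[OF B(2) X]] card_carrier by (rule ordLeq_transitive)
  moreover have "\<kappa> =o |I|" using Cinfinite card_of_Field_ordIso ordIso_symmetric by blast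
  ultimately have "|I| =o |B|" by (meson ordIso_iff_ordLeq ordLeq_ordIso_trans)
  then obtain s where "bij_betw s I B" using card_of_ordIso by blast
  then show thesis using that[of s] B by (auto simp: bij_betw_def)
qed

lemma residue_iso_exists:
  assumes p: "Factorial_Ring.prime p"
  shows "\<exists>\<mu>. residue_iso (free_Abelian_group I) G p \<mu>"
proof -
  let ?A = "sum_group I (\<lambda>_. localized_int_group p)" and ?F = "free_Abelian_group I"
  interpret A: residue_iso ?F ?A p "int_vec I"
    using prime_gt_0_nat[OF p] by (rule residue_iso_sum_localized)
  obtain f where f: "pure_embedding f ?A G"
    using pure_embedding_exists[OF A.G card_of_sum_localized[OF Cinfinite]] by blast
  have fh: "f \<in> hom ?A G" using f by (simp add: pure_embedding_def mon_def)
  have f0: "f \<circ> int_vec I \<in> hom ?F G" by (rule Group.hom_compose[OF A.hom fh])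
  have ind: "int p dvd Poly_Mapping.lookup k i"
    if k: "Poly_Mapping.keys k \<subseteq> I" "(f \<circ> int_vec I) k \<in> multiples G p" for k i
  proof -
    \<comment> \<open>Purity of \<open>f\<close> carries divisibility by \<open>p\<close> back from
      \<open>G\<close> to the sum of localized integers, where \<open>int_vec_dvd\<close>
      applies.\<close>
    obtain y where y: "y \<in> carrier G" "y [^] p = f (int_vec I k)" using k(2) by (auto simp: multiples_def)
    have "int_vec I k \<in> carrier ?A" using k(1) A.\<mu>.hom_closed by simp
    then obtain z where "z \<in> carrier ?A" "z [^]\<^bsub>?A\<^esub> p = int_vec I k"
      using f y unfolding pure_embedding_iff[OF A.G.is_group is_group] by blast
    then have "int_vec I k \<in> multiples ?A p" unfolding multiples_def by (metis image_eqI)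
    then show ?thesis by (rule int_vec_dvd[OF k(1)])
  qed
  have p1: "p \<noteq> 1" using p by auto
  have cl: "(f \<circ> int_vec I) (frag_of i) \<in> carrier G" if "i \<in> I" for i
    using hom_in_carrier[OF f0, of "frag_of i"] that by simp
  obtain s where s: "inj_on s I" "s ` I \<subseteq> carrier G" "indep p (s ` I)"
    and span: "\<forall>x\<in>carrier G.
      \<exists>m k. \<not> int p dvd m \<and> Poly_Mapping.keys k \<subseteq> s ` I \<and> congr G p (free_eval k) (x [^] (m::int))"
    using indep_family_exists[OF f0 p1 subset_refl ind cl] .
  define \<mu> where "\<mu> k = free_eval (frag_extend (frag_of \<circ> s) k)" for k
  have "residue_iso ?F G p \<mu>"
  proof (rule residue_iso.intro)
    show "comm_group ?F" by (rule abelian_free_Abelian_group)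
    show "torsion_free_group G" by (rule torsion_free)
    show "0 < p" using p by (rule prime_gt_0_nat)
    show "\<mu> \<in> hom ?F G" unfolding \<mu>_def by (rule free_eval_frag_extend_hom[OF s(2)])
    show "k \<in> multiples ?F p" if "k \<in> carrier ?F" "\<mu> k \<in> multiples G p" for k
      using that indep_frag_extend[OF s(3,1) subset_refl] unfolding \<mu>_def
      by (intro multiples_free_Abelian_groupI) auto
    fix g assume g: "g \<in> carrier G"
    obtain m k w where mk: "\<not> int p dvd m" "Poly_Mapping.keys k \<subseteq> s ` I"
      and w: "w \<in> carrier G" "g [^] m = free_eval k \<otimes> w [^] p"
      using bspec[OF span g] by (auto simp: congr_def)
    have e: "Poly_Mapping.keys k \<subseteq> carrier G" "free_eval k \<in> carrier G" using mk(2) s(2) by auto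
    \<comment> \<open>The span reaches only the multiple of \<open>g\<close> by \<open>m\<close>. As
      \<open>m\<close> is invertible modulo the prime \<open>p\<close>, scaling by its inverse
      \<open>u\<close> recovers \<open>g\<close> itself.\<close>
    have "coprime m (int p)"
      using mk(1) p by (metis coprime_commute prime_imp_coprime prime_nat_int_transfer)
    then obtain u v where uv: "u * m + v * int p = 1"
      by (metis bezout_int coprime_imp_gcd_eq_1)
    have "g = g [^] (m * u + v * int p)" using uv g by (simp add: mult.commute)
    also have "\<dots> = (g [^] m) [^] u \<otimes> (g [^] v) [^] p"
      using g by (simp add: int_pow_mult int_pow_pow flip: int_pow_int)
    also have "(g [^] m) [^] u = free_eval k [^] u \<otimes> (w [^] u) [^] p"
      unfolding w(2) using e(2) w(1) by (simp add: int_pow_distrib int_pow_pow mult.commute flip: int_pow_int)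
    finally have g_eq: "g = free_eval k [^] u \<otimes> (w [^] u \<otimes> g [^] v) [^] p"
      using e(2) w(1) g by (simp add: nat_pow_distrib m_assoc)
    have "Poly_Mapping.keys (frag_cmul u k) \<subseteq> s ` I" using mk(2) by auto
    then obtain l where l: "Poly_Mapping.keys l \<subseteq> I" "frag_extend (frag_of \<circ> s) l = frag_cmul u k"
      by (rule frag_extend_frag_of_surj)
    have "\<mu> l = free_eval k [^] u" using l(2) e(1) by (simp add: \<mu>_def free_eval_frag_cmul)
    then have "congr G p (\<mu> l) g" using g_eq w(1) g by (intro congrI[of "w [^] u \<otimes> g [^] v"]) auto
    then show "\<exists>k\<in>carrier ?F. congr G p (\<mu> k) g" using l(1) by auto
  qed
  then show ?thesis by blast
qed

definition divisible_part :: "'a set"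
  where "divisible_part = {x \<in> carrier G. \<forall>n>0. x \<in> multiples G n}"

lemma free_eval_divisible_part:
  assumes "Poly_Mapping.keys k \<subseteq> divisible_part"
  shows "free_eval k \<in> divisible_part"
proof -
  have DG: "divisible_part \<subseteq> carrier G" by (auto simp: divisible_part_def)
  show ?thesis
  proof (rule free_Abelian_group_induct[OF assms])
    show "free_eval 0 \<in> divisible_part" using one_in_multiples by (simp add: divisible_part_def)
    fix x y assume xy: "Poly_Mapping.keys x \<subseteq> divisible_part" "Poly_Mapping.keys y \<subseteq> divisible_part"
      "free_eval x \<in> divisible_part" "free_eval y \<in> divisible_part"
    have "free_eval (x - y) = free_eval (x + frag_cmul (-1) y)" by simp
    also have "\<dots> = free_eval x \<otimes> free_eval (frag_cmul (-1) y)"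
      using xy DG by (subst free_eval_add) auto
    also have "free_eval (frag_cmul (-1) y) = inv (free_eval y)"
      using xy(2) DG free_eval_frag_cmul[of y "-1"] free_eval_closed[of y] by (simp add: int_pow_neg)
    finally have "free_eval (x - y) = free_eval x \<otimes> inv (free_eval y)" .
    then show "free_eval (x - y) \<in> divisible_part"
      using xy(3,4) subgroup.m_closed[OF subgroup_multiples] subgroup.m_inv_closed[OF subgroup_multiples]
      by (simp add: divisible_part_def)
  qed (use DG in auto)
qed

text \<open>The divisible part is divisible in its own right: roots are unique, so a root of
  \<open>y\<close> of exponent \<open>m * n\<close> is also an \<open>n\<close>-th root of the
  chosen \<open>x\<close>.\<close>

lemma divisible_part_root:
  assumes y: "y \<in> divisible_part" and m: "m > 0"
  obtains x where "x \<in> divisible_part" "x [^] (m::nat) = y"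
proof -
  obtain x where x: "x \<in> carrier G" "y = x [^] m" using y m by (auto simp: divisible_part_def multiples_def)
  have "x \<in> multiples G n" if n: "n > 0" for n
  proof -
    have "y \<in> multiples G (m * n)" using y m n by (simp add: divisible_part_def)
    then obtain z where z: "z \<in> carrier G" "y = z [^] (m * n)" by (auto simp: multiples_def)
    then have "(z [^] n) [^] m = x [^] m" using x(2) by (simp add: nat_pow_pow mult.commute)
    then have "z [^] n = x" by (rule torsion_free_group_pow_inject[OF torsion_free nat_pow_closed[OF z(1)] x(1) m])
    then show ?thesis using z(1) by (auto simp: multiples_def)
  qed
  then show thesis using that x by (auto simp: divisible_part_def)
qed

lemma rational_projection_exists:
  obtains \<pi> where "\<pi> \<in> hom G (sum_group I (\<lambda>_. rat_group))"
    "\<And>x. x \<in> divisible_part \<Longrightarrow> \<pi> x = \<one>\<^bsub>sum_group I (\<lambda>_. rat_group)\<^esub> \<Longrightarrow> x = \<one>"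
    "\<And>q. q \<in> carrier (sum_group I (\<lambda>_. rat_group)) \<Longrightarrow> \<exists>x\<in>divisible_part. \<pi> x = q"
proof -
  let ?F = "free_Abelian_group I"
  define Q where "Q = sum_group I (\<lambda>_. rat_group)"
  have Q_eq: "sum_group I (\<lambda>_. rat_group\<lparr>carrier := UNIV\<rparr>) = Q" by (simp add: Q_def rat_group_def)
  interpret Q: rat_subgroup UNIV I by (rule rat_subgroup_UNIV)
  note carrier_Q = Q.carrier_A[unfolded Q_eq] and mult_Q = Q.mult_A[unfolded Q_eq]
    and one_Q = Q.one_A[unfolded Q_eq] and pow_Q = Q.pow_A[unfolded Q_eq]
    and tf_Q = Q.torsion_free_A[unfolded Q_eq] and int_vec_hom_Q = Q.int_vec_hom[unfolded Q_eq]
  interpret Q: comm_group Q using tf_Q by (simp add: torsion_free_group_def)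
  obtain f where f: "pure_embedding f Q G"
    using pure_embedding_exists[OF tf_Q] card_of_sum_rat[OF Cinfinite] unfolding Q_def by blast
  have fh: "f \<in> hom Q G" and finj: "inj_on f (carrier Q)" using f by (auto simp: pure_embedding_def mon_def)
  interpret f: group_hom Q G f using fh by (simp add: group_hom_def group_hom_axioms_def)
  have f0: "f \<circ> int_vec I \<in> hom ?F G" by (rule Group.hom_compose[OF int_vec_hom_Q fh])
  have ivQ: "int_vec I k \<in> carrier Q" if "Poly_Mapping.keys k \<subseteq> I" for k
    using hom_in_carrier[OF int_vec_hom_Q] that by simp
  have ind: "int 0 dvd Poly_Mapping.lookup k i"
    if k: "Poly_Mapping.keys k \<subseteq> I" "(f \<circ> int_vec I) k \<in> multiples G 0" for k i
  proof (cases "i \<in> I")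
    case True
    have "f (int_vec I k) = f \<one>\<^bsub>Q\<^esub>" using k(2) by (auto simp: multiples_def)
    then have "int_vec I k = \<one>\<^bsub>Q\<^esub>" using inj_onD[OF finj] ivQ[OF k(1)] by blast
    then have "int_vec I k i = 0" using True by (simp add: one_Q)
    then show ?thesis using True by (simp add: int_vec_def)
  next
    case False
    then show ?thesis using k(1) by (metis dvd_0_right in_keys_iff subsetD)
  qed
  have DG: "divisible_part \<subseteq> carrier G" by (auto simp: divisible_part_def)
  have fD: "(f \<circ> int_vec I) (frag_of i) \<in> divisible_part" if i: "i \<in> I" for i
  proof -
    have v: "int_vec I (frag_of i) \<in> carrier Q" using i by (simp add: ivQ)
    have "f (int_vec I (frag_of i)) \<in> multiples G n" if n: "n > 0" for n
    proof -
      \<comment> \<open>The sum of rationals is divisible, and homomorphic images inherit this;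
        hence the unit vectors land in the divisible part.\<close>
      define w where "w = (\<lambda>j\<in>I. int_vec I (frag_of i) j / of_nat n)"
      have w: "w \<in> carrier Q" using v n by (simp add: carrier_Q w_def cong: conj_cong)
      have "int_vec I (frag_of i) = w [^]\<^bsub>Q\<^esub> n"
        using n unfolding pow_Q[OF w] by (auto simp: w_def int_vec_def)
      then have "f (int_vec I (frag_of i)) = f w [^] n" using w by (simp add: f.hom_nat_pow)
      then show ?thesis using f.hom_closed[OF w] by (auto simp: multiples_def)
    qed
    then show ?thesis using f.hom_closed[OF v] by (simp add: divisible_part_def)
  qed
  obtain s where s: "inj_on s I" "s ` I \<subseteq> divisible_part" "indep 0 (s ` I)"
    and span_D: "\<forall>x\<in>divisible_part.
      \<exists>m k. \<not> int 0 dvd m \<and> Poly_Mapping.keys k \<subseteq> s ` I \<and> congr G 0 (free_eval k) (x [^] (m::int))"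
    using indep_family_exists[OF f0 zero_neq_one DG ind fD] .
  have sG: "s ` I \<subseteq> carrier G" using s(2) DG by blast
  obtain C where C: "s ` I \<subseteq> C" "C \<subseteq> carrier G" "indep 0 C"
    and span_C: "\<forall>x\<in>carrier G.
      \<exists>m k. \<not> int 0 dvd m \<and> Poly_Mapping.keys k \<subseteq> C \<and> congr G 0 (free_eval k) (x [^] (m::int))"
    using maximal_indep_exists[OF s(3) sG subset_refl zero_neq_one] .
  have c0: "congr G 0 x y \<longleftrightarrow> y = x" if "x \<in> carrier G" for x y using that by (auto simp: congr_def)
  have "\<forall>x\<in>carrier G. \<exists>m k. m \<noteq> 0 \<and> Poly_Mapping.keys k \<subseteq> C \<and> free_eval k = x [^] (m::int)"
  proof
    fix x assume "x \<in> carrier G"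
    then obtain m k where "\<not> int 0 dvd m" "Poly_Mapping.keys k \<subseteq> C" "congr G 0 (free_eval k) (x [^] m)"
      using span_C by blast
    moreover have "free_eval k \<in> carrier G" using calculation(2) C(2) by simp
    ultimately show "\<exists>m k. m \<noteq> 0 \<and> Poly_Mapping.keys k \<subseteq> C \<and> free_eval k = x [^] (m::int)"
      using c0 by (intro exI[of _ m] exI[of _ k]) auto
  qed
  then obtain M K where MK: "\<And>x. x \<in> carrier G \<Longrightarrow> M x \<noteq> 0"
    "\<And>x. x \<in> carrier G \<Longrightarrow> Poly_Mapping.keys (K x) \<subseteq> C"
    "\<And>x. x \<in> carrier G \<Longrightarrow> free_eval (K x) = x [^] (M x :: int)"
    by metis
  \<comment> \<open>The multiple of \<open>x\<close> by \<open>M x\<close> is the combination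
    \<open>K x\<close> over \<open>C\<close>. Its coefficients are divided by \<open>M x\<close>,
    and only those at the \<open>s i\<close> are kept. By \<open>\<pi>_eq\<close> every other such
    multiple gives the same result.\<close>
  define \<pi> where "\<pi> x = (\<lambda>i\<in>I. of_int (Poly_Mapping.lookup (K x) (s i)) / rat_of_int (M x))" for x
  have \<pi>_eq: "\<pi> x = (\<lambda>i\<in>I. of_int (Poly_Mapping.lookup k (s i)) / rat_of_int m)"
    if x: "x \<in> carrier G" and k: "Poly_Mapping.keys k \<subseteq> C" "m \<noteq> 0" "free_eval k = x [^] m" for x k m
  proof -
    have kG: "Poly_Mapping.keys k \<subseteq> carrier G" "Poly_Mapping.keys (K x) \<subseteq> carrier G"
      using k(1) MK(2)[OF x] C(2) by auto
    \<comment> \<open>The cross-multiplied difference of two representations evaluates to the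
      neutral element, so independence of \<open>C\<close> makes its coefficients vanish and the two
      fractions agree.\<close>
    let ?d = "frag_cmul m (K x) + frag_cmul (- M x) k"
    have "free_eval ?d = free_eval (K x) [^] m \<otimes> free_eval k [^] (- M x)"
      using kG by (subst free_eval_add) (auto simp: free_eval_frag_cmul)
    also have "\<dots> = x [^] (M x * m) \<otimes> x [^] (m * - M x)"
      using x k(3) MK(3)[OF x] by (simp add: int_pow_pow)
    also have "\<dots> = x [^] (M x * m + m * - M x)" using x by (simp only: int_pow_mult)
    also have "\<dots> = \<one>" by simp
    finally have "free_eval ?d \<in> multiples G 0" using one_in_multiples by simp
    moreover have "Poly_Mapping.keys ?d \<subseteq> C"
      using keys_add[of "frag_cmul m (K x)" "frag_cmul (- M x) k"] k(1) MK(2)[OF x] by auto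
    ultimately have "int 0 dvd Poly_Mapping.lookup ?d b" for b using C(3) unfolding indep_def by blast
    then have "m * Poly_Mapping.lookup (K x) b = M x * Poly_Mapping.lookup k b" for b
      by (simp add: lookup_add)
    then have "rat_of_int m * of_int (Poly_Mapping.lookup (K x) b) = of_int (M x) * of_int (Poly_Mapping.lookup k b)" for b
      by (metis of_int_mult)
    then show ?thesis unfolding \<pi>_def using k(2) MK(1)[OF x]
      by (intro restrict_ext) (simp add: field_simps)
  qed
  have \<pi>_closed: "\<pi> x \<in> carrier Q" if x: "x \<in> carrier G" for x
  proof -
    have "{i \<in> I. \<pi> x i \<noteq> 0} \<subseteq> {i \<in> I. s i \<in> Poly_Mapping.keys (K x)}" by (auto simp: \<pi>_def in_keys_iff)
    moreover have "finite {i \<in> I. s i \<in> Poly_Mapping.keys (K x)}"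
      using finite_vimage_IntI[OF finite_keys s(1), of "K x"] by (rule rev_finite_subset) auto
    ultimately have "finite {i \<in> I. \<pi> x i \<noteq> 0}" by (rule finite_subset)
    then show ?thesis by (simp add: carrier_Q \<pi>_def)
  qed
  show thesis
  proof (rule that[of \<pi>], unfold Q_def[symmetric])
    show "\<pi> \<in> hom G Q"
    proof (rule homI)
      fix x y assume x: "x \<in> carrier G" and y: "y \<in> carrier G"
      have kG: "Poly_Mapping.keys (K y) \<subseteq> carrier G" "Poly_Mapping.keys (K x) \<subseteq> carrier G"
        using MK(2)[OF y] MK(2)[OF x] C(2) by auto
      let ?k = "frag_cmul (M y) (K x) + frag_cmul (M x) (K y)"
      have "free_eval ?k = free_eval (K x) [^] M y \<otimes> free_eval (K y) [^] M x"
        using kG by (subst free_eval_add) (auto simp: free_eval_frag_cmul)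
      also have "\<dots> = (x \<otimes> y) [^] (M x * M y)"
        using x y MK(3) by (simp add: int_pow_pow int_pow_distrib mult.commute)
      finally have 1: "free_eval ?k = (x \<otimes> y) [^] (M x * M y)" .
      have 2: "Poly_Mapping.keys ?k \<subseteq> C"
        using keys_add[of "frag_cmul (M y) (K x)" "frag_cmul (M x) (K y)"] MK(2)[OF x] MK(2)[OF y] by auto
      have 3: "M x * M y \<noteq> 0" using MK(1) x y by simp
      have "\<pi> (x \<otimes> y) = (\<lambda>i\<in>I. of_int (Poly_Mapping.lookup ?k (s i)) / rat_of_int (M x * M y))"
        using x y by (intro \<pi>_eq[OF _ 2 3 1]) simp
      also have "\<dots> = \<pi> x \<otimes>\<^bsub>Q\<^esub> \<pi> y"
        unfolding mult_Q using MK(1)[OF x] MK(1)[OF y]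
        by (intro restrict_ext) (simp add: \<pi>_def lookup_add field_simps)
      finally show "\<pi> (x \<otimes> y) = \<pi> x \<otimes>\<^bsub>Q\<^esub> \<pi> y" .
    qed (rule \<pi>_closed)
    show "x = \<one>" if x: "x \<in> divisible_part" "\<pi> x = \<one>\<^bsub>Q\<^esub>" for x
    proof -
      have xG: "x \<in> carrier G" using x(1) DG by blast
      \<comment> \<open>The representation has to come from \<open>span_D\<close>: it involves only
        the elements \<open>s i\<close>, so vanishing of the kept coordinates leaves no nonzero
        coefficient.\<close>
      obtain m k where mk: "m \<noteq> 0" "Poly_Mapping.keys k \<subseteq> s ` I" "congr G 0 (free_eval k) (x [^] (m::int))"
        using bspec[OF span_D x(1)] by auto
      have "free_eval k \<in> carrier G" using mk(2) sG by simp
      then have e: "free_eval k = x [^] m" using mk(3) c0 by simp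
      have "\<pi> x = (\<lambda>i\<in>I. of_int (Poly_Mapping.lookup k (s i)) / rat_of_int m)"
        using mk(2) C(1) by (intro \<pi>_eq[OF xG _ mk(1) e]) blast
      then have eq: "(\<lambda>i\<in>I. of_int (Poly_Mapping.lookup k (s i)) / rat_of_int m) = (\<lambda>i\<in>I. 0)" using x(2) one_Q by simp
      have "Poly_Mapping.lookup k (s i) = 0" if "i \<in> I" for i
        using fun_cong[OF eq, of i] that mk(1) by simp
      then have "b \<notin> Poly_Mapping.keys k" for b using mk(2) by (auto simp: in_keys_iff)
      then have "k = 0" by (metis all_not_in_conv keys_eq_empty)
      then have "x [^] m = \<one>" using e by simp
      moreover have "\<bar>m\<bar> = m \<or> \<bar>m\<bar> = - m" by arith
      ultimately have "x [^] \<bar>m\<bar> = \<one>" using xG by (auto simp: int_pow_neg)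
      then have "x [^] nat \<bar>m\<bar> = \<one>" using int_pow_int[of G x "nat \<bar>m\<bar>"] by simp
      then show "x = \<one>" using torsion_free xG mk(1) unfolding torsion_free_group_def
        by (metis zero_less_abs_iff zero_less_nat_eq)
    qed
    show "\<exists>x\<in>divisible_part. \<pi> x = q" if q: "q \<in> carrier Q" for q
    proof -
      obtain m k where mk: "m > 0" "Poly_Mapping.keys k \<subseteq> I"
        "\<forall>i\<in>I. of_nat m * q i = of_int (Poly_Mapping.lookup k i)"
        using sum_rat_common_denominator[OF q[unfolded Q_def]] by blast
      \<comment> \<open>Clearing denominators gives an integer combination of the
        \<open>s i\<close>. It lies in the divisible part and can be divided by \<open>m\<close>
        again without leaving it.\<close>
      let ?k = "frag_extend (frag_of \<circ> s) k"
      have k: "Poly_Mapping.keys ?k \<subseteq> s ` I" using keys_frag_extend_frag_of[of s k] mk(2) by blast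
      have "free_eval ?k \<in> divisible_part" using k s(2) by (intro free_eval_divisible_part) blast
      then obtain x where x: "x \<in> divisible_part" "x [^] m = free_eval ?k"
        using divisible_part_root mk(1) by blast
      have "free_eval ?k = x [^] int m" using x(2) by (simp add: int_pow_int)
      then have "\<pi> x = (\<lambda>i\<in>I. of_int (Poly_Mapping.lookup ?k (s i)) / rat_of_int (int m))"
        using x(1) DG k C(1) mk(1) by (intro \<pi>_eq) auto
      also have "\<dots> = q"
      proof
        fix i
        show "(\<lambda>i\<in>I. of_int (Poly_Mapping.lookup ?k (s i)) / rat_of_int (int m)) i = q i"
        proof (cases "i \<in> I")
          case True
          then show ?thesis
            using mk(1,3) lookup_frag_extend_frag_of[OF s(1) mk(2)] by (auto simp: field_simps)
        next
          case False
          then show ?thesis using q by (auto simp: carrier_Q PiE_iff extensional_def)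
        qed
      qed
      finally show ?thesis using x(1) by blast
    qed
  qed
qed

lemma iso_sum_product:
  "G \<cong> sum_group I (\<lambda>_. rat_group) \<times>\<times> product_group {p::nat. Factorial_Ring.prime p}
      (\<lambda>p. padic_completion p (sum_group I (\<lambda>_. localized_int_group p)))"
proof -
  let ?F = "free_Abelian_group I" and ?P = "{p::nat. Factorial_Ring.prime p}"
  define A where "A p = sum_group I (\<lambda>_. localized_int_group p)" for p
  define Q where "Q = sum_group I (\<lambda>_. rat_group)"
  have "group Q" unfolding Q_def using comm_group.axioms(2)[OF comm_group_rat_group] by simp
  then interpret Q: group Q .
  obtain \<mu> where \<mu>: "\<And>p. Factorial_Ring.prime p \<Longrightarrow> residue_iso ?F G p (\<mu> p)"
    using residue_iso_exists by metis
  have same: "same_residues ?F G (A p) p (\<mu> p) (int_vec I)" if "Factorial_Ring.prime p" for p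
    unfolding same_residues_def A_def
    using \<mu>[OF that] residue_iso_sum_localized prime_gt_0_nat[OF that] by blast
  define \<psi> where "\<psi> p = same_residues.to_completion ?F G (A p) p (\<mu> p) (int_vec I)" for p
  note hom_\<psi> = same_residues.to_completion_hom[OF same, folded \<psi>_def]
    and \<psi>_eq_iff = same_residues.to_completion_eq_iff[OF same, folded \<psi>_def]
    and \<psi>_approx = same_residues.to_completion_approx[OF same, folded \<psi>_def]
  obtain \<pi> where \<pi>: "\<pi> \<in> hom G Q"
    "\<And>x. x \<in> divisible_part \<Longrightarrow> \<pi> x = \<one>\<^bsub>Q\<^esub> \<Longrightarrow> x = \<one>"
    "\<And>q. q \<in> carrier Q \<Longrightarrow> \<exists>x\<in>divisible_part. \<pi> x = q"
    using rational_projection_exists unfolding Q_def by blast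
  interpret \<pi>: group_hom G Q \<pi> using \<pi>(1) by (simp add: group_hom_def group_hom_axioms_def)
  define R where "R = product_group ?P (\<lambda>p. padic_completion p (A p))"
  define \<Phi> where "\<Phi> g = (\<pi> g, \<lambda>p\<in>?P. \<psi> p g)" for g
  have "(\<lambda>g. \<lambda>p\<in>?P. \<psi> p g) \<in> hom G R"
    unfolding R_def
  proof (rule homI)
    show "(\<lambda>p\<in>?P. \<psi> p g) \<in> carrier (product_group ?P (\<lambda>p. padic_completion p (A p)))" if "g \<in> carrier G" for g
      using hom_in_carrier[OF hom_\<psi>] that by auto
    show "(\<lambda>p\<in>?P. \<psi> p (g \<otimes> h)) =
        (\<lambda>p\<in>?P. \<psi> p g) \<otimes>\<^bsub>product_group ?P (\<lambda>p. padic_completion p (A p))\<^esub> (\<lambda>p\<in>?P. \<psi> p h)"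
      if "g \<in> carrier G" "h \<in> carrier G" for g h
      using hom_mult[OF hom_\<psi>] that by auto
  qed
  then have hom_\<Phi>: "\<Phi> \<in> hom G (Q \<times>\<times> R)" unfolding \<Phi>_def using \<pi>(1) by (simp add: hom_paired)
  have "inj_on \<Phi> (carrier G)"
  proof (rule inj_onI)
    fix g h assume g: "g \<in> carrier G" and h: "h \<in> carrier G" and eq: "\<Phi> g = \<Phi> h"
    have "congr G (p ^ n) g h" if "Factorial_Ring.prime p" for p n
    proof -
      have "(\<lambda>p\<in>?P. \<psi> p g) p = (\<lambda>p\<in>?P. \<psi> p h) p" using eq unfolding \<Phi>_def by (metis prod.inject)
      then show ?thesis using \<psi>_eq_iff[OF that g h] that by simp
    qed
    then have "inv g \<otimes> h \<in> multiples G (p ^ n)" if "Factorial_Ring.prime p" for p n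
      using that congr_iff_multiples[OF g h] by blast
    then have "inv g \<otimes> h \<in> divisible_part"
      using multiples_prime_powers[of "inv g \<otimes> h"] g h by (simp add: divisible_part_def)
    moreover have "\<pi> (inv g \<otimes> h) = \<one>\<^bsub>Q\<^esub>" using eq g h by (simp add: \<Phi>_def)
    ultimately have "inv g \<otimes> h = \<one>" using \<pi>(2) by blast
    then show "g = h" using g h by (metis inv_closed inv_equality inv_inv)
  qed
  moreover have "\<Phi> ` carrier G = carrier (Q \<times>\<times> R)"
  proof
    show "\<Phi> ` carrier G \<subseteq> carrier (Q \<times>\<times> R)" using hom_in_carrier[OF hom_\<Phi>] by blast
    show "carrier (Q \<times>\<times> R) \<subseteq> \<Phi> ` carrier G"
    proof
      fix z assume "z \<in> carrier (Q \<times>\<times> R)"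
      then obtain q y where z: "z = (q, y)" and q: "q \<in> carrier Q" and y: "y \<in> carrier R" by auto
      have "\<forall>p. \<exists>g. Factorial_Ring.prime p \<longrightarrow> (\<forall>n. g n \<in> carrier G) \<and> (\<forall>n. congr G (p ^ n) (g n) (g (Suc n))) \<and>
          (\<forall>x\<in>carrier G. (\<forall>n. congr G (p ^ n) (g n) x) \<longrightarrow> \<psi> p x = y p)"
      proof
        fix p
        have "y p \<in> carrier (padic_completion p (A p))" if "Factorial_Ring.prime p"
          using y that by (auto simp: R_def)
        then show "\<exists>g. Factorial_Ring.prime p \<longrightarrow> (\<forall>n. g n \<in> carrier G) \<and> (\<forall>n. congr G (p ^ n) (g n) (g (Suc n))) \<and>
          (\<forall>x\<in>carrier G. (\<forall>n. congr G (p ^ n) (g n) x) \<longrightarrow> \<psi> p x = y p)"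
          using \<psi>_approx[of p "y p"] by blast
      qed
      then obtain g where g: "\<And>p. Factorial_Ring.prime p \<Longrightarrow> (\<forall>n. g p n \<in> carrier G) \<and>
          (\<forall>n. congr G (p ^ n) (g p n) (g p (Suc n))) \<and>
          (\<forall>x\<in>carrier G. (\<forall>n. congr G (p ^ n) (g p n) x) \<longrightarrow> \<psi> p x = y p)"
        by metis
      obtain x where x: "x \<in> carrier G" "\<And>p n. Factorial_Ring.prime p \<Longrightarrow> congr G (p ^ n) (g p n) x"
        using solve_padic_systems[of g] g by blast
      \<comment> \<open>\<open>x\<close> already has the prescribed images in the completions; the
        correction \<open>d\<close> from the divisible part repairs the rational coordinates and
        leaves those images unchanged.\<close>
      have "inv\<^bsub>Q\<^esub> \<pi> x \<otimes>\<^bsub>Q\<^esub> q \<in> carrier Q" using x(1) q by simp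
      then obtain d where d: "d \<in> divisible_part" "\<pi> d = inv\<^bsub>Q\<^esub> \<pi> x \<otimes>\<^bsub>Q\<^esub> q" using \<pi>(3) by blast
      have dG: "d \<in> carrier G" using d(1) by (simp add: divisible_part_def)
      have "\<pi> (x \<otimes> d) = q" using x(1) dG d(2) q by (simp flip: Q.m_assoc)
      moreover have "\<psi> p (x \<otimes> d) = y p" if p: "Factorial_Ring.prime p" for p
      proof -
        have "congr G (p ^ n) x (x \<otimes> d)" for n
        proof -
          have "d \<in> multiples G (p ^ n)" using d(1) prime_gt_0_nat[OF p] by (simp add: divisible_part_def)
          then show ?thesis by (auto simp: congr_def multiples_def)
        qed
        then have "\<psi> p x = \<psi> p (x \<otimes> d)" using \<psi>_eq_iff[OF p x(1)] x(1) dG by simp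
        then show ?thesis using g[OF p] x p by simp
      qed
      then have "(\<lambda>p\<in>?P. \<psi> p (x \<otimes> d)) = y"
        using y by (auto simp: R_def PiE_iff extensional_def)
      ultimately have "z = \<Phi> (x \<otimes> d)" by (simp add: \<Phi>_def z)
      then show "z \<in> \<Phi> ` carrier G" using x(1) dG by simp
    qed
  qed
  ultimately have "\<Phi> \<in> iso G (Q \<times>\<times> R)" using hom_\<Phi> by (simp add: iso_def bij_betw_def)
  then show ?thesis unfolding Q_def R_def A_def is_iso_def by blast
qed

end

theorem theorem4p15:
  fixes \<kappa> :: "'l rel" and \<alpha> :: "'i rel" and G :: "('a, 'b) monoid_scheme"
  assumes "Cinfinite \<kappa>"
    and "Well_order \<alpha>" and "Field \<alpha> \<noteq> {}" and "wo_rel.isLimOrd \<alpha>"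
    and "\<alpha> <o cardSuc \<kappa>"
    and "cardSuc natLeq \<le>o cofinality \<alpha>"
    and "limit_model \<kappa> \<alpha> G"
  shows "G \<cong> sum_group (Field \<kappa>) (\<lambda>_. rat_group) \<times>\<times>
    product_group {p::nat. Factorial_Ring.prime p}
      (\<lambda>p. padic_completion p (sum_group (Field \<kappa>) (\<lambda>_. localized_int_group p)))"
  using limit_model_countably_universal[OF assms(1,2,4-7)] by (rule countably_universal.iso_sum_product)

end
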